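(* For every positive integer $n$ there is a number $N_1=N_1(n)\geq n$ with the following property. Every strictly 2-intersecting family $\mathcal{K}$ of $N_1\geq 3$ compact convex sets in $\mathbb{R}^2$ contains a sequence $K_1,\ldots,K_n$ of $n$ distinct elements that is realized by a sequence of $n$ lines $\ell_1,\ldots,\ell_n$ which is either an $n$-cap or an $n$-cup.
   Context: A finite family of convex sets is strictly 2-intersecting if every two of its sets have non-empty intersection but no three distinct sets of the family have a common point. A sequence $K_1,\ldots,K_n$ of convex sets in $\mathbb{R}^2$ is realized by a sequence of lines $\ell_1,\ldots,\ell_n$ in $\mathbb{R}^2$ if for all $1\leq i<j\leq n$ the segments $s_i=K_i\cap\ell_i$ and $s_j=K_j\cap\ell_j$ intersect. An ordered sequence $\ell_1,\ldots,\ell_n$ of $n\geq 3$ non-vertical lines in $\mathbb{R}^2$, no three passing through a common point, is an $n$-cap (resp. $n$-cup) if their slopes form a strictly decreasing (resp. strictly increasing) sequence and, for all $1\leq i<j<k\leq n$, the point $\ell_i\cap\ell_k$ lies above (resp. below) $\ell_j$. *)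

theory Defs
  imports "HOL-Analysis.Analysis"
begin

definition strictly_2_intersecting :: "(real^2) set set \<Rightarrow> bool" where
  "strictly_2_intersecting F \<longleftrightarrow>
     finite F \<and> (\<forall>A\<in>F. convex A) \<and>
     (\<forall>A\<in>F. \<forall>B\<in>F. A \<noteq> B \<longrightarrow> A \<inter> B \<noteq> {}) \<and>
     (\<forall>A\<in>F. \<forall>B\<in>F. \<forall>C\<in>F. A \<noteq> B \<and> A \<noteq> C \<and> B \<noteq> C \<longrightarrow> A \<inter> B \<inter> C = {})"

definition is_line :: "(real^2) set \<Rightarrow> bool" where
  "is_line L \<longleftrightarrow> affine L \<and> aff_dim L = 1"

definition nonvertical_line :: "(real^2) set \<Rightarrow> bool" where
  "nonvertical_line L \<longleftrightarrow> is_line L \<and> \<not> (\<exists>c. L = {p. p $ 1 = c})"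

text \<open>Meaningful for non-vertical lines only.\<close>

definition line_slope :: "(real^2) set \<Rightarrow> real" where
  "line_slope L = (THE m. \<forall>p\<in>L. \<forall>q\<in>L. q $ 2 - p $ 2 = m * (q $ 1 - p $ 1))"

definition above_line :: "real^2 \<Rightarrow> (real^2) set \<Rightarrow> bool" where
  "above_line p L \<longleftrightarrow> (\<exists>q\<in>L. q $ 1 = p $ 1 \<and> q $ 2 < p $ 2)"

definition below_line :: "real^2 \<Rightarrow> (real^2) set \<Rightarrow> bool" where
  "below_line p L \<longleftrightarrow> (\<exists>q\<in>L. q $ 1 = p $ 1 \<and> p $ 2 < q $ 2)"

text \<open>Sequences of length \<open>n\<close> are functions on \<open>nat\<close> of which only the values at \<open>1, \<dots>, n\<close> matter.\<close>

definition realized_by :: "nat \<Rightarrow> (nat \<Rightarrow> (real^2) set) \<Rightarrow> (nat \<Rightarrow> (real^2) set) \<Rightarrow> bool" where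
  "realized_by n K l \<longleftrightarrow>
     (\<forall>i\<in>{1..n}. is_line (l i)) \<and>
     (\<forall>i j. 1 \<le> i \<and> i < j \<and> j \<le> n \<longrightarrow> (K i \<inter> l i) \<inter> (K j \<inter> l j) \<noteq> {})"

text \<open>
  Caps and cups are usually considered for \<open>n \<ge> 3\<close>. For \<open>n < 3\<close> the conditions on
  triples below are void, and only non-verticality and monotonicity of the slopes remain.
\<close>

definition n_cap :: "nat \<Rightarrow> (nat \<Rightarrow> (real^2) set) \<Rightarrow> bool" where
  "n_cap n l \<longleftrightarrow>
     (\<forall>i\<in>{1..n}. nonvertical_line (l i)) \<and>
     (\<forall>i j k. 1 \<le> i \<and> i < j \<and> j < k \<and> k \<le> n \<longrightarrow> l i \<inter> l j \<inter> l k = {}) \<and>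
     (\<forall>i j. 1 \<le> i \<and> i < j \<and> j \<le> n \<longrightarrow> line_slope (l i) > line_slope (l j)) \<and>
     (\<forall>i j k. 1 \<le> i \<and> i < j \<and> j < k \<and> k \<le> n \<longrightarrow>
        (\<exists>p. l i \<inter> l k = {p} \<and> above_line p (l j)))"

definition n_cup :: "nat \<Rightarrow> (nat \<Rightarrow> (real^2) set) \<Rightarrow> bool" where
  "n_cup n l \<longleftrightarrow>
     (\<forall>i\<in>{1..n}. nonvertical_line (l i)) \<and>
     (\<forall>i j k. 1 \<le> i \<and> i < j \<and> j < k \<and> k \<le> n \<longrightarrow> l i \<inter> l j \<inter> l k = {}) \<and>
     (\<forall>i j. 1 \<le> i \<and> i < j \<and> j \<le> n \<longrightarrow> line_slope (l i) < line_slope (l j)) \<and>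
     (\<forall>i j k. 1 \<le> i \<and> i < j \<and> j < k \<and> k \<le> n \<longrightarrow>
        (\<exists>p. l i \<inter> l k = {p} \<and> below_line p (l j)))"

end

theory Submission
  imports Defs "HOL-Library.Ramsey"
begin

text \<open>
  Pairwise intersecting convex sets have a common vertical transversal \<open>L\<close>. By Ramsey's theorem we
  may assume that no two of the sets \<open>K\<^sub>1, K\<^sub>2, \<dots>\<close> meet on \<open>L\<close>, that points \<open>x\<^sub>i \<in> K\<^sub>i \<inter> L\<close> are
  ordered by height, and that points \<open>q\<^sub>i\<^sub>j \<in> K\<^sub>i \<inter> K\<^sub>j\<close> all lie strictly on one side of \<open>L\<close>. For
  \<open>i < j < k < l\<close> the arcs \<open>x\<^sub>i q\<^sub>i\<^sub>k x\<^sub>k\<close> and \<open>x\<^sub>j q\<^sub>j\<^sub>l x\<^sub>l\<close> interleave on \<open>L\<close> and hence cross. Apply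
  Ramsey's theorem to the way in which they cross. Either segments of the form \<open>x\<^sub>i q\<^sub>i\<^sub>k\<close> (or all
  of the form \<open>x\<^sub>k q\<^sub>i\<^sub>k\<close>) already give pairwise crossing segments, or, with \<open>0\<close> and \<open>\<infinity>\<close> denoting the
  extreme indices, \<open>x\<^sub>j q\<^sub>j\<^sub>\<infinity>\<close> meets \<open>x\<^sub>k q\<^sub>0\<^sub>k\<close> whenever \<open>j < k\<close>. In the latter case the triangles
  \<open>x\<^sub>j q\<^sub>j\<^sub>\<infinity> q\<^sub>0\<^sub>j\<close> intersect pairwise without containing each other's vertices, which forces two
  corresponding sides of any two of them to meet; a last application of Ramsey's theorem selects
  one kind of side.

  Three convex sets without a common point cannot have collinear pairwise intersection points.
  Therefore the lines through pairwise crossing segments have distinct slopes and no three of them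
  are concurrent, so Ramsey's theorem for triples yields a cap or a cup.
\<close>

subsection \<open>Ramsey's theorem for increasing index sequences\<close>

text \<open>The classes \<open>P k\<close> may overlap: one admissible class is chosen for every
  \<open>r\<close>-set, so that a user of the lemma only has to prove a disjunction. The homogeneous
  set is returned as its increasing enumeration \<open>g\<close>, which keeps the order of the
  indices.\<close>

lemma ramsey_increasing:
  fixes c m r :: nat
  shows "\<exists>N::nat. \<forall>P :: nat \<Rightarrow> nat list \<Rightarrow> bool.
    (\<forall>xs. strict_sorted xs \<and> set xs \<subseteq> {..<N} \<and> length xs = r \<longrightarrow> (\<exists>k<c. P k xs)) \<longrightarrow>
    (\<exists>k<c. \<exists>g. (\<forall>i<m. g i < N) \<and> (\<forall>j<m. \<forall>i<j. g i < g j) \<and>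
      (\<forall>xs. strict_sorted xs \<and> set xs \<subseteq> {..<m} \<and> length xs = r \<longrightarrow> P k (map g xs)))"
proof -
  obtain N :: nat where N: "partn_lst {..<N} (replicate c m) r"
    using ramsey_full by blast
  show ?thesis
  proof (rule exI[of _ N], intro allI impI)
    fix P :: "nat \<Rightarrow> nat list \<Rightarrow> bool"
    assume P: "\<forall>xs. strict_sorted xs \<and> set xs \<subseteq> {..<N} \<and> length xs = r \<longrightarrow> (\<exists>k<c. P k xs)"
    \<comment> \<open>Ramsey's theorem colours sets, whereas \<open>P\<close> speaks of lists; the
      sorted enumeration translates, and \<open>SOME\<close> settles overlaps.\<close>
    define f where "f S = (SOME k. k < c \<and> P k (sorted_list_of_set S))" for S
    have f: "f S < c \<and> P (f S) (sorted_list_of_set S)" if "S \<in> [{..<N}]\<^bsup>r\<^esup>" for S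
    proof -
      have "\<exists>k. k < c \<and> P k (sorted_list_of_set S)"
        using that P[rule_format, of "sorted_list_of_set S"] by (auto simp: nsets_def)
      then show ?thesis unfolding f_def by (rule someI_ex)
    qed
    then have "f \<in> [{..<N}]\<^bsup>r\<^esup> \<rightarrow> {..<c}" by auto
    from partn_lstE[OF N this] obtain k H where k: "k < c"
      and H: "H \<in> [{..<N}]\<^bsup>m\<^esup>" and fH: "f ` [H]\<^bsup>r\<^esup> \<subseteq> {k}"
      by (auto simp: nsets_def)
    define g where "g i = sorted_list_of_set H ! i" for i
    have fin: "finite H" "card H = m" "H \<subseteq> {..<N}" using H by (auto simp: nsets_def)
    have gH: "g i \<in> H" if "i < m" for i
      using that fin nth_mem[of i "sorted_list_of_set H"] by (simp add: g_def)
    have gN: "g i < N" if "i < m" for i using gH[OF that] fin(3) by auto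
    have gm: "g i < g j" if "i < j" "j < m" for i j
      using that fin sorted_wrt_nth_less[OF strict_sorted_list_of_set, of i j H]
      by (simp add: g_def)
    have "P k (map g xs)" if xs: "strict_sorted xs" "set xs \<subseteq> {..<m}" "length xs = r" for xs
    proof -
      have "strict_sorted (map g xs)"
        unfolding sorted_wrt_map using xs(1)
        by (rule sorted_wrt_mono_rel[rotated]) (use xs(2) gm in auto)
      moreover from this have "distinct (map g xs)"
        using strict_sorted_iff by blast
      \<comment> \<open>Since \<open>g\<close> is increasing, the sorted enumeration of the image
        set is \<open>map g xs\<close>; thus the colour of that set is a statement about this very
        list.\<close>
      ultimately have eq: "sorted_list_of_set (g ` set xs) = map g xs"
        using sorted_list_of_set.idem_if_sorted_distinct[of "map g xs"]
        by (simp add: strict_sorted_iff)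
      have "card (g ` set xs) = r"
        using distinct_card[OF \<open>distinct (map g xs)\<close>] xs(3) by simp
      then have "g ` set xs \<in> [H]\<^bsup>r\<^esup>"
        using xs gH by (auto simp: nsets_def)
      moreover from this have "g ` set xs \<in> [{..<N}]\<^bsup>r\<^esup>"
        using nsets_mono[OF fin(3)] by blast
      ultimately show ?thesis using f[of "g ` set xs"] fH eq by auto
    qed
    then show "\<exists>k<c. \<exists>g. (\<forall>i<m. g i < N) \<and> (\<forall>j<m. \<forall>i<j. g i < g j) \<and>
      (\<forall>xs. strict_sorted xs \<and> set xs \<subseteq> {..<m} \<and> length xs = r \<longrightarrow> P k (map g xs))"
      using k gN gm by blast
  qed
qed

text \<open>For a fixed arity the list is unpacked into its entries, so that the classes become
  curried predicates. Arities 3 and 4 are treated alike below.\<close>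

lemma ramsey_increasing_2:
  fixes c m :: nat
  shows "\<exists>N::nat. \<forall>P :: nat \<Rightarrow> nat \<Rightarrow> nat \<Rightarrow> bool.
    (\<forall>j<N. \<forall>i<j. \<exists>k<c. P k i j) \<longrightarrow>
    (\<exists>k<c. \<exists>g. (\<forall>i<m. g i < N) \<and> (\<forall>j<m. \<forall>i<j. g i < g j) \<and>
      (\<forall>j<m. \<forall>i<j. P k (g i) (g j)))"
proof -
  obtain N where N: "\<forall>P :: nat \<Rightarrow> nat list \<Rightarrow> bool.
    (\<forall>xs. strict_sorted xs \<and> set xs \<subseteq> {..<N} \<and> length xs = 2 \<longrightarrow> (\<exists>k<c. P k xs)) \<longrightarrow>
    (\<exists>k<c. \<exists>g. (\<forall>i<m. g i < N) \<and> (\<forall>j<m. \<forall>i<j. g i < g j) \<and>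
      (\<forall>xs. strict_sorted xs \<and> set xs \<subseteq> {..<m} \<and> length xs = 2 \<longrightarrow> P k (map g xs)))"
    using ramsey_increasing by (rule exE)
  show ?thesis
  proof (rule exI[of _ N], intro allI impI)
    fix P :: "nat \<Rightarrow> nat \<Rightarrow> nat \<Rightarrow> bool"
    assume P: "\<forall>j<N. \<forall>i<j. \<exists>k<c. P k i j"
    have "\<exists>k<c. \<exists>g. (\<forall>i<m. g i < N) \<and> (\<forall>j<m. \<forall>i<j. g i < g j) \<and>
      (\<forall>xs. strict_sorted xs \<and> set xs \<subseteq> {..<m} \<and> length xs = 2 \<longrightarrow>
        P k (map g xs ! 0) (map g xs ! 1))"
      by (rule N[THEN spec, of "\<lambda>k xs. P k (xs ! 0) (xs ! 1)", THEN mp]) (use P in \<open>auto simp: length_Suc_conv numeral_eq_Suc\<close>)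
    then obtain k g where *: "k < c" "\<forall>i<m. g i < N" "\<forall>j<m. \<forall>i<j. g i < g j" and
      g: "\<And>xs. strict_sorted xs \<Longrightarrow> set xs \<subseteq> {..<m} \<Longrightarrow> length xs = 2 \<Longrightarrow>
        P k (map g xs ! 0) (map g xs ! 1)" by blast
    have "\<forall>j<m. \<forall>i<j. P k (g i) (g j)"
    proof (intro allI impI)
      fix i j assume "j < m" "i < j"
      then show "P k (g i) (g j)" using g[of "[i, j]"] by auto
    qed
    with * show "\<exists>k<c. \<exists>g. (\<forall>i<m. g i < N) \<and> (\<forall>j<m. \<forall>i<j. g i < g j) \<and>
      (\<forall>j<m. \<forall>i<j. P k (g i) (g j))" by blast
  qed
qed

lemma ramsey_increasing_3:
  fixes c m :: nat
  shows "\<exists>N::nat. \<forall>P :: nat \<Rightarrow> nat \<Rightarrow> nat \<Rightarrow> nat \<Rightarrow> bool.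
    (\<forall>h<N. \<forall>j<h. \<forall>i<j. \<exists>k<c. P k i j h) \<longrightarrow>
    (\<exists>k<c. \<exists>g. (\<forall>i<m. g i < N) \<and> (\<forall>j<m. \<forall>i<j. g i < g j) \<and>
      (\<forall>h<m. \<forall>j<h. \<forall>i<j. P k (g i) (g j) (g h)))"
proof -
  obtain N where N: "\<forall>P :: nat \<Rightarrow> nat list \<Rightarrow> bool.
    (\<forall>xs. strict_sorted xs \<and> set xs \<subseteq> {..<N} \<and> length xs = 3 \<longrightarrow> (\<exists>k<c. P k xs)) \<longrightarrow>
    (\<exists>k<c. \<exists>g. (\<forall>i<m. g i < N) \<and> (\<forall>j<m. \<forall>i<j. g i < g j) \<and>
      (\<forall>xs. strict_sorted xs \<and> set xs \<subseteq> {..<m} \<and> length xs = 3 \<longrightarrow> P k (map g xs)))"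
    using ramsey_increasing by (rule exE)
  show ?thesis
  proof (rule exI[of _ N], intro allI impI)
    fix P :: "nat \<Rightarrow> nat \<Rightarrow> nat \<Rightarrow> nat \<Rightarrow> bool"
    assume P: "\<forall>h<N. \<forall>j<h. \<forall>i<j. \<exists>k<c. P k i j h"
    have "\<exists>k<c. \<exists>g. (\<forall>i<m. g i < N) \<and> (\<forall>j<m. \<forall>i<j. g i < g j) \<and>
      (\<forall>xs. strict_sorted xs \<and> set xs \<subseteq> {..<m} \<and> length xs = 3 \<longrightarrow>
        P k (map g xs ! 0) (map g xs ! 1) (map g xs ! 2))"
      by (rule N[THEN spec, of "\<lambda>k xs. P k (xs ! 0) (xs ! 1) (xs ! 2)", THEN mp]) (use P in \<open>auto simp: length_Suc_conv numeral_eq_Suc\<close>)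
    then obtain k g where *: "k < c" "\<forall>i<m. g i < N" "\<forall>j<m. \<forall>i<j. g i < g j" and
      g: "\<And>xs. strict_sorted xs \<Longrightarrow> set xs \<subseteq> {..<m} \<Longrightarrow> length xs = 3 \<Longrightarrow>
        P k (map g xs ! 0) (map g xs ! 1) (map g xs ! 2)" by blast
    have "\<forall>h<m. \<forall>j<h. \<forall>i<j. P k (g i) (g j) (g h)"
    proof (intro allI impI)
      fix i j h assume "h < m" "j < h" "i < j"
      then show "P k (g i) (g j) (g h)" using g[of "[i, j, h]"] by auto
    qed
    with * show "\<exists>k<c. \<exists>g. (\<forall>i<m. g i < N) \<and> (\<forall>j<m. \<forall>i<j. g i < g j) \<and>
      (\<forall>h<m. \<forall>j<h. \<forall>i<j. P k (g i) (g j) (g h))" by blast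
  qed
qed

lemma ramsey_increasing_4:
  fixes c m :: nat
  shows "\<exists>N::nat. \<forall>P :: nat \<Rightarrow> nat \<Rightarrow> nat \<Rightarrow> nat \<Rightarrow> nat \<Rightarrow> bool.
    (\<forall>l<N. \<forall>h<l. \<forall>j<h. \<forall>i<j. \<exists>k<c. P k i j h l) \<longrightarrow>
    (\<exists>k<c. \<exists>g. (\<forall>i<m. g i < N) \<and> (\<forall>j<m. \<forall>i<j. g i < g j) \<and>
      (\<forall>l<m. \<forall>h<l. \<forall>j<h. \<forall>i<j. P k (g i) (g j) (g h) (g l)))"
proof -
  obtain N where N: "\<forall>P :: nat \<Rightarrow> nat list \<Rightarrow> bool.
    (\<forall>xs. strict_sorted xs \<and> set xs \<subseteq> {..<N} \<and> length xs = 4 \<longrightarrow> (\<exists>k<c. P k xs)) \<longrightarrow>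
    (\<exists>k<c. \<exists>g. (\<forall>i<m. g i < N) \<and> (\<forall>j<m. \<forall>i<j. g i < g j) \<and>
      (\<forall>xs. strict_sorted xs \<and> set xs \<subseteq> {..<m} \<and> length xs = 4 \<longrightarrow> P k (map g xs)))"
    using ramsey_increasing by (rule exE)
  show ?thesis
  proof (rule exI[of _ N], intro allI impI)
    fix P :: "nat \<Rightarrow> nat \<Rightarrow> nat \<Rightarrow> nat \<Rightarrow> nat \<Rightarrow> bool"
    assume P: "\<forall>l<N. \<forall>h<l. \<forall>j<h. \<forall>i<j. \<exists>k<c. P k i j h l"
    have "\<exists>k<c. \<exists>g. (\<forall>i<m. g i < N) \<and> (\<forall>j<m. \<forall>i<j. g i < g j) \<and>
      (\<forall>xs. strict_sorted xs \<and> set xs \<subseteq> {..<m} \<and> length xs = 4 \<longrightarrow>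
        P k (map g xs ! 0) (map g xs ! 1) (map g xs ! 2) (map g xs ! 3))"
      by (rule N[THEN spec, of "\<lambda>k xs. P k (xs ! 0) (xs ! 1) (xs ! 2) (xs ! 3)", THEN mp]) (use P in \<open>auto simp: length_Suc_conv numeral_eq_Suc\<close>)
    then obtain k g where *: "k < c" "\<forall>i<m. g i < N" "\<forall>j<m. \<forall>i<j. g i < g j" and
      g: "\<And>xs. strict_sorted xs \<Longrightarrow> set xs \<subseteq> {..<m} \<Longrightarrow> length xs = 4 \<Longrightarrow>
        P k (map g xs ! 0) (map g xs ! 1) (map g xs ! 2) (map g xs ! 3)" by blast
    have "\<forall>l<m. \<forall>h<l. \<forall>j<h. \<forall>i<j. P k (g i) (g j) (g h) (g l)"
    proof (intro allI impI)
      fix i j h l assume "l < m" "h < l" "j < h" "i < j"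
      then show "P k (g i) (g j) (g h) (g l)" using g[of "[i, j, h, l]"] by auto
    qed
    with * show "\<exists>k<c. \<exists>g. (\<forall>i<m. g i < N) \<and> (\<forall>j<m. \<forall>i<j. g i < g j) \<and>
      (\<forall>l<m. \<forall>h<l. \<forall>j<h. \<forall>i<j. P k (g i) (g j) (g h) (g l))" by blast
  qed
qed

text \<open>Sort the values of \<open>key\<close> and pull them back along its inverse. This serves
  to order sets by height on the transversal and lines by slope.\<close>

lemma finite_enumerate_by_key:
  fixes key :: "'a \<Rightarrow> 'b::linorder"
  assumes "finite S" "inj_on key S"
  shows "\<exists>g. bij_betw g {..<card S} S \<and> (\<forall>j<card S. \<forall>i<j. key (g i) < key (g j))"
proof -
  define ks where "ks = sorted_list_of_set (key ` S)"
  have len: "length ks = card S" using assms by (simp add: ks_def card_image)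
  have set: "set ks = key ` S" using assms by (simp add: ks_def)
  have "distinct ks" by (simp add: ks_def)
  then have 1: "bij_betw ((!) ks) {..<card S} (key ` S)"
    using len set by (intro bij_betw_nth) auto
  have 2: "bij_betw (inv_into S key) (key ` S) S"
    using assms(2) by (simp add: bij_betw_inv_into inj_on_imp_bij_betw)
  have "bij_betw (inv_into S key \<circ> (!) ks) {..<card S} S"
    using bij_betw_trans[OF 1 2] .
  moreover have "key ((inv_into S key \<circ> (!) ks) i) = ks ! i" if "i < card S" for i
    using that len set nth_mem[of i ks] by (simp add: f_inv_into_f)
  moreover have "ks ! i < ks ! j" if "i < j" "j < card S" for i j
    using that len sorted_wrt_nth_less[OF strict_sorted_list_of_set, of i j "key ` S"]
    by (simp add: ks_def)
  ultimately show ?thesis by (metis order.strict_trans)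
qed

subsection \<open>Crossing segments in the plane\<close>

text \<open>Affine coordinates rather than the standard ones: \<open>X\<close> can then be the
  signed distance from any vertical line, with the sign chosen so that the relevant half-plane is
  \<open>X > 0\<close>. Left and right are thereby treated at once.\<close>

locale planar_chart =
  fixes X Y :: "'a::real_vector \<Rightarrow> real"
  assumes X_affine: "X ((1 - t) *\<^sub>R a + t *\<^sub>R b) = (1 - t) * X a + t * X b"
    and Y_affine: "Y ((1 - t) *\<^sub>R a + t *\<^sub>R b) = (1 - t) * Y a + t * Y b"
    and chart_inj: "X a = X b \<Longrightarrow> Y a = Y b \<Longrightarrow> a = b"
begin

text \<open>The orientation determinant, twice the signed area of the triangle \<open>a b z\<close>:
  positive when \<open>z\<close> lies to the left of the line directed from \<open>a\<close> to
  \<open>b\<close>.\<close>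

definition side :: "'a \<Rightarrow> 'a \<Rightarrow> 'a \<Rightarrow> real" where
  "side a b z = (X b - X a) * (Y z - Y a) - (Y b - Y a) * (X z - X a)"

lemma side_affine: "side a b ((1 - t) *\<^sub>R c + t *\<^sub>R d) = (1 - t) * side a b c + t * side a b d"
  unfolding side_def X_affine Y_affine by (simp add: algebra_simps)

lemma side_start [simp]: "side a b a = 0" and side_end [simp]: "side a b b = 0"
  by (simp_all add: side_def)

lemma side_segment_eq_0: "z \<in> closed_segment a b \<Longrightarrow> side a b z = 0"
  by (auto simp: in_segment side_affine)

lemma side_0_on_line:
  assumes "side a b z = 0" "a \<noteq> b"
  obtains t where "z = (1 - t) *\<^sub>R a + t *\<^sub>R b"
proof (cases "X a = X b")
  case True
  with assms chart_inj have ne: "Y b - Y a \<noteq> 0" by auto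
  define t where "t = (Y z - Y a) / (Y b - Y a)"
  have "X z = X a" using assms(1) True ne by (simp add: side_def)
  moreover have "t * (Y b - Y a) = Y z - Y a" using ne by (simp add: t_def)
  ultimately have "z = (1 - t) *\<^sub>R a + t *\<^sub>R b"
    using True by (intro chart_inj; unfold X_affine Y_affine) (simp_all add: algebra_simps)
  then show ?thesis by (rule that)
next
  case False
  then have ne: "X b - X a \<noteq> 0" by simp
  define t where "t = (X z - X a) / (X b - X a)"
  have 1: "t * (X b - X a) = X z - X a" using ne by (simp add: t_def)
  have "Y z = Y a + t * (Y b - Y a)"
    using assms(1) ne by (simp add: t_def side_def field_simps)
  with 1 have "z = (1 - t) *\<^sub>R a + t *\<^sub>R b"
    by (intro chart_inj; unfold X_affine Y_affine) (simp_all add: algebra_simps)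
  then show ?thesis by (rule that)
qed

lemma side_zero_on_segment:
  assumes "side a b c \<le> 0" "0 \<le> side a b d"
  obtains z where "z \<in> closed_segment c d" "side a b z = 0"
proof (cases "side a b d = side a b c")
  case True
  with assms that[of c] show ?thesis by auto
next
  case False
  define t where "t = - side a b c / (side a b d - side a b c)"
  have "0 \<le> t" "t \<le> 1" using assms False by (auto simp: t_def field_simps)
  moreover have "side a b ((1 - t) *\<^sub>R c + t *\<^sub>R d) = 0"
    unfolding side_affine t_def using False by (simp add: field_simps)
  ultimately show ?thesis using that by (auto simp: in_segment)
qed

text \<open>Pasch's axiom for a segment whose endpoints lie outside a convex set containing the triangle.\<close>

lemma crossing_segment_meets_other_side:
  fixes s t a b c :: 'a
  assumes ab: "closed_segment s t \<inter> closed_segment a b \<noteq> {}"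
    and T: "convex T" "a \<in> T" "b \<in> T" "c \<in> T" and st: "s \<notin> T" "t \<notin> T"
  shows "closed_segment s t \<inter> closed_segment a c \<noteq> {} \<or>
    closed_segment s t \<inter> closed_segment b c \<noteq> {}"
proof -
  obtain p where p: "p \<in> closed_segment s t" "p \<in> closed_segment a b" using ab by blast
  have pT: "p \<in> T" using p(2) T closed_segment_subset by blast
  have "s \<noteq> t" using p(1) pT st by auto
  from p(1) obtain u where u: "0 \<le> u" "u \<le> 1" "p = (1 - u) *\<^sub>R s + u *\<^sub>R t"
    by (auto simp: in_segment)
  \<comment> \<open>The crossing point \<open>p\<close> lies in \<open>T\<close> and between
    \<open>s\<close> and \<open>t\<close>. If \<open>h\<close> were beyond an endpoint, that
    endpoint would lie between \<open>p\<close> and \<open>h\<close>, hence in \<open>T\<close> by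
    convexity.\<close>
  have hit: "h \<in> closed_segment s t" if h: "h \<in> T" "side s t h = 0" for h
  proof -
    obtain v where v: "h = (1 - v) *\<^sub>R s + v *\<^sub>R t"
      using side_0_on_line[OF h(2) \<open>s \<noteq> t\<close>] .
    have seg: "(1 - w) *\<^sub>R s + w *\<^sub>R t \<in> T" if "u \<le> w \<and> w \<le> v \<or> v \<le> w \<and> w \<le> u" for w
    proof (cases "u = v")
      case True
      with that have "w = u" by auto
      with pT u(3) show ?thesis by simp
    next
      case False
      define r where "r = (w - u) / (v - u)"
      have r: "0 \<le> r" "r \<le> 1" using that False by (auto simp: r_def divide_simps)
      have "r * (v - u) = w - u" using False by (simp add: r_def)
      then have w: "w = (1 - r) * u + r * v" by (simp add: algebra_simps)
      have "(1 - w) *\<^sub>R s + w *\<^sub>R t = (1 - r) *\<^sub>R p + r *\<^sub>R h"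
        unfolding u(3) v w by (simp add: algebra_simps)
      with r T(1) pT h(1) show ?thesis by (simp add: convexD_alt)
    qed
    have "0 \<le> v" using seg[of 0] st(1) u by (cases "0 \<le> v") auto
    moreover have "v \<le> 1" using seg[of 1] st(2) u by (cases "v \<le> 1") auto
    ultimately show ?thesis using v by (auto simp: in_segment)
  qed
  have ac: "closed_segment a c \<subseteq> T" "closed_segment b c \<subseteq> T"
    using T closed_segment_subset by blast+
  obtain w where w: "0 \<le> w" "w \<le> 1" "p = (1 - w) *\<^sub>R a + w *\<^sub>R b"
    using p(2) by (auto simp: in_segment)
  have "(1 - w) * side s t a + w * side s t b = 0"
    using side_segment_eq_0[OF p(1)] w(3) by (simp add: side_affine)
  \<comment> \<open>A convex combination of the two values vanishes, so \<open>a\<close> and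
    \<open>b\<close> lie on opposite closed sides of the line. Wherever \<open>c\<close> lies, it is
    then opposite to one of them.\<close>
  then have "side s t a \<le> 0 \<and> 0 \<le> side s t b \<or> side s t b \<le> 0 \<and> 0 \<le> side s t a"
    using w(1,2) convex_bound_lt[of "side s t a" 0 "side s t b" "1 - w" w]
      convex_bound_lt[of "- side s t a" 0 "- side s t b" "1 - w" w]
    by (cases "side s t a" "0::real" rule: linorder_cases;
        cases "side s t b" "0::real" rule: linorder_cases) auto
  then have "(\<exists>z\<in>closed_segment a c. side s t z = 0) \<or> (\<exists>z\<in>closed_segment b c. side s t z = 0)"
  proof -
    have zero: "\<exists>z\<in>closed_segment p q. side s t z = 0"
      if "side s t p \<le> 0 \<and> 0 \<le> side s t q \<or> side s t q \<le> 0 \<and> 0 \<le> side s t p" for p q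
      using that side_zero_on_segment[of s t p q] side_zero_on_segment[of s t q p]
      by (metis closed_segment_commute)
    assume "side s t a \<le> 0 \<and> 0 \<le> side s t b \<or> side s t b \<le> 0 \<and> 0 \<le> side s t a"
    then show ?thesis using zero[of a c] zero[of b c] by linarith
  qed
  then show ?thesis using hit ac by blast
qed

section \<open>Arcs with endpoints on the axis \<open>X = 0\<close>\<close>

lemma closed_segmentI_X:
  assumes "X a = 0" "side a b z = 0" "0 \<le> X z" "X z \<le> X b" "0 < X b"
  shows "z \<in> closed_segment a b"
proof -
  have "a \<noteq> b" using assms by auto
  with assms(2) obtain t where t: "z = (1 - t) *\<^sub>R a + t *\<^sub>R b"
    using side_0_on_line by blast
  then have "X z = t * X b" by (simp add: X_affine assms(1))
  with assms have "0 \<le> t" "t \<le> 1"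
    by (auto simp: zero_le_mult_iff mult_le_cancel_right1)
  with t show ?thesis by (auto simp: in_segment)
qed

lemma X_nonneg_segment:
  assumes "z \<in> closed_segment a b" "0 \<le> X a" "0 \<le> X b"
  shows "0 \<le> X z"
  using assms by (auto simp: in_segment X_affine)

text \<open>A segment leaving an intersection of two half-planes passes through its boundary: the
  intermediate value theorem is applied to the minimum of the two affine functions.\<close>

lemma two_sides_zero_on_segment:
  assumes "0 \<le> side a b y" "0 \<le> side c d y" "side a b z < 0 \<or> side c d z < 0"
  obtains w where "w \<in> closed_segment y z"
    "side a b w = 0 \<and> 0 \<le> side c d w \<or> side c d w = 0 \<and> 0 \<le> side a b w"
proof -
  define m where "m t = min (side a b ((1 - t) *\<^sub>R y + t *\<^sub>R z)) (side c d ((1 - t) *\<^sub>R y + t *\<^sub>R z))"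
    for t :: real
  have "continuous_on {0..1} m"
    unfolding m_def side_affine by (intro continuous_intros)
  moreover have "m 1 \<le> 0" "0 \<le> m 0" using assms by (auto simp: m_def)
  ultimately obtain t where "0 \<le> t" "t \<le> 1" "m t = 0"
    using IVT2'[of m 1 0 0] by auto
  then show ?thesis
    using that[of "(1 - t) *\<^sub>R y + t *\<^sub>R z"] by (auto simp: m_def in_segment min_def split: if_splits)
qed

text \<open>The lines \<open>x1 q\<close> and \<open>q x3\<close> bound a wedge with apex
  \<open>q\<close> whose part in \<open>X \<ge> 0\<close> is the triangle \<open>x1 q x3\<close>.
  The path \<open>x2 r x4\<close> starts strictly inside the wedge, ends outside it and stays in
  \<open>X \<ge> 0\<close>, so it crosses one of the two legs.\<close>

lemma interleaved_arcs_cross: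
  assumes X: "X x1 = 0" "X x2 = 0" "X x3 = 0" "X x4 = 0"
    and Y: "Y x1 < Y x2" "Y x2 < Y x3" "Y x3 < Y x4" and q: "0 < X q" and r: "0 < X r"
  shows "(closed_segment x1 q \<union> closed_segment x3 q) \<inter>
    (closed_segment x2 r \<union> closed_segment x4 r) \<noteq> {}"
proof -
  have A: "side x1 q z = X q * (Y z - Y x1) - (Y q - Y x1) * X z" for z
    by (simp add: side_def X)
  have B: "side q x3 z = X q * (Y x3 - Y z) + (Y q - Y x3) * X z" for z
    by (simp add: side_def X algebra_simps)
  have x2: "0 < side x1 q x2" "0 < side q x3 x2" and x4: "side q x3 x4 < 0"
    using X Y q by (simp_all add: A B mult_less_0_iff)
  obtain w where w: "w \<in> closed_segment x2 r \<union> closed_segment x4 r"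
    and w0: "side x1 q w = 0 \<and> 0 \<le> side q x3 w \<or> side q x3 w = 0 \<and> 0 \<le> side x1 q w"
  \<comment> \<open>If \<open>r\<close> is outside the wedge, the first piece of the path leaves it;
    otherwise the second piece does.\<close>
  proof (cases "side x1 q r < 0 \<or> side q x3 r < 0")
    case True
    with x2 show ?thesis
      using that two_sides_zero_on_segment[of x1 q x2 q x3 r]
      by (metis Un_iff less_imp_le)
  next
    case False
    then show ?thesis
      using that x4 two_sides_zero_on_segment[of x1 q r q x3 x4]
      by (metis Un_iff closed_segment_commute not_less)
  qed
  have Xw: "0 \<le> X w" using w X r X_nonneg_segment[of w] by auto
  \<comment> \<open>The right-hand side is the sum of the two side functions at
    \<open>w\<close>.\<close>
  have "0 \<le> (X q - X w) * (Y x3 - Y x1)"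
    using w0 A[of w] B[of w] by (auto simp: algebra_simps)
  then have "X w \<le> X q" using Y by (simp add: zero_le_mult_iff)
  moreover have "side x3 q w = - side q x3 w" by (simp add: side_def algebra_simps)
  ultimately have "w \<in> closed_segment x1 q \<or> w \<in> closed_segment x3 q"
    using w0 Xw q X closed_segmentI_X[of x1 q w] closed_segmentI_X[of x3 q w] by auto
  with w show ?thesis by blast
qed

text \<open>Let \<open>p\<close> be the given crossing point. As \<open>x4 r\<close> crosses the
  line \<open>x1 q\<close> at \<open>p\<close>, the point \<open>r\<close> is not on the side of
  \<open>x2\<close>, so \<open>x2 r\<close> crosses that line at some \<open>z\<close>. Seen from
  the line \<open>x4 r\<close>, \<open>z\<close> is on the side of \<open>x1\<close>, which places
  it between \<open>x1\<close> and \<open>p\<close>.\<close>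

lemma outer_crossing_imp_first_crossing:
  assumes X: "X x1 = 0" "X x2 = 0" "X x4 = 0"
    and Y: "Y x1 < Y x2" "Y x2 < Y x4" and q: "0 < X q" and r: "0 < X r"
    and meet: "closed_segment x1 q \<inter> closed_segment x4 r \<noteq> {}"
  shows "closed_segment x1 q \<inter> closed_segment x2 r \<noteq> {}"
proof -
  have A: "side x1 q z = X q * (Y z - Y x1) - (Y q - Y x1) * X z" for z
    by (simp add: side_def X)
  have C: "side r x4 z = X r * (Y x4 - Y z) + (Y r - Y x4) * X z" for z
    by (simp add: side_def X algebra_simps)
  obtain p where p: "p \<in> closed_segment x1 q" "p \<in> closed_segment x4 r" using meet by blast
  have A_pos: "0 < side x1 q x2" "0 < side x1 q x4" and C_pos: "0 < side r x4 x1" "0 < side r x4 x2"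
    using X Y q r by (simp_all add: A C)
  have Ap: "side x1 q p = 0" using p(1) by (rule side_segment_eq_0)
  have Cp: "side r x4 p = 0" using p(2) side_segment_eq_0 closed_segment_commute by blast
  have Ar: "side x1 q r \<le> 0"
  proof -
    obtain t where t: "0 \<le> t" "t \<le> 1" "p = (1 - t) *\<^sub>R x4 + t *\<^sub>R r"
      using p(2) by (auto simp: in_segment)
    have "(1 - t) * side x1 q x4 + t * side x1 q r = 0"
      using Ap t(3) by (simp add: side_affine)
    then show ?thesis using A_pos t
      by (smt (verit) mult_nonneg_nonneg mult_pos_pos)
  qed
  obtain z where z: "z \<in> closed_segment r x2" "side x1 q z = 0"
    using side_zero_on_segment[of x1 q r x2] Ar A_pos by auto
  have Cz: "0 \<le> side r x4 z"
    using z(1) C_pos(2) by (auto simp: in_segment side_affine)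
  have Xz: "0 \<le> X z" using z(1) X r X_nonneg_segment[of z r x2] by simp
  obtain t where t: "0 \<le> t" "t \<le> 1" "p = (1 - t) *\<^sub>R x1 + t *\<^sub>R q"
    using p(1) by (auto simp: in_segment)
  obtain s where s: "z = (1 - s) *\<^sub>R x1 + s *\<^sub>R q"
    using side_0_on_line[OF z(2)] q X by (metis less_irrefl)
  have "X z = s * X q" by (simp add: s X_affine X)
  then have s0: "0 \<le> s" using Xz q by (simp add: zero_le_mult_iff)
  have Cp': "(1 - t) * side r x4 x1 + t * side r x4 q = 0"
    using Cp t(3) by (simp add: side_affine)
  have "0 \<le> (1 - s) * side r x4 x1 + s * side r x4 q"
    using Cz s by (simp add: side_affine)
  \<comment> \<open>Along \<open>x1 q\<close> the function \<open>side r x4\<close> is positive at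
    parameter 0, zero at \<open>t\<close> and nonnegative at \<open>s\<close>. Multiplying by
    \<open>t\<close> and subtracting \<open>s\<close> times the equation at \<open>t\<close>
    eliminates its value at \<open>q\<close> and leaves \<open>s \<le> t\<close>.\<close>
  then have "0 \<le> t * ((1 - s) * side r x4 x1 + s * side r x4 q)"
    using t(1) by simp
  also have "\<dots> = (t - s) * side r x4 x1 + s * ((1 - t) * side r x4 x1 + t * side r x4 q)"
    by (simp add: algebra_simps)
  finally have "0 \<le> (t - s) * side r x4 x1" using Cp' by simp
  then have "s \<le> t" using C_pos(1) by (simp add: zero_le_mult_iff)
  then have "z \<in> closed_segment x1 q" using s s0 t by (auto simp: in_segment)
  with z(1) show ?thesis by (auto simp: closed_segment_commute)
qed

text \<open>Of the four pairs of pieces that can cross, the outermost one, \<open>x1 q\<close> with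
  \<open>x4 r\<close>, reduces to \<open>x1 q\<close> with \<open>x2 r\<close>. The three remaining
  types serve as Ramsey colours.\<close>

lemma interleaved_arcs_cases:
  assumes X: "X x1 = 0" "X x2 = 0" "X x3 = 0" "X x4 = 0"
    and Y: "Y x1 < Y x2" "Y x2 < Y x3" "Y x3 < Y x4" and q: "0 < X q" and r: "0 < X r"
  shows "closed_segment x1 q \<inter> closed_segment x2 r \<noteq> {} \<or>
    closed_segment x3 q \<inter> closed_segment x4 r \<noteq> {} \<or>
    closed_segment x2 r \<inter> closed_segment x3 q \<noteq> {}"
  using interleaved_arcs_cross[OF X Y q r]
    outer_crossing_imp_first_crossing[OF X(1,2,4) Y(1) _ q r] Y
  by fastforce

section \<open>Triangles with one vertex on the axis\<close>

text \<open>The point \<open>x\<close> is strictly below the line \<open>x' f'\<close>. Crossing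
  along \<open>x e\<close> puts \<open>e\<close> strictly above it, and crossing back along
  \<open>e f\<close> puts \<open>f\<close> on or below it; so the slope of \<open>x' f'\<close>
  separates the two slopes.\<close>

lemma slope_less_of_segment_meeting_two_sides:
  assumes X: "X x = 0" "X x' = 0" and Y: "Y x < Y x'"
    and pos: "0 < X e" "0 < X f" "0 < X f'"
    and u: "closed_segment x' f' \<inter> closed_segment x e \<noteq> {}" "e \<notin> closed_segment x' f'"
    and w: "closed_segment x' f' \<inter> closed_segment e f \<noteq> {}"
  shows "(Y f - Y x') / X f < (Y e - Y x') / X e"
proof -
  have A: "side x' f' z = X f' * (Y z - Y x') - (Y f' - Y x') * X z" for z
    by (simp add: side_def X)
  have Ax: "side x' f' x < 0" using X Y pos by (simp add: A mult_less_0_iff)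
  obtain t where t: "0 \<le> t" "t \<le> 1" "(1 - t) *\<^sub>R x + t *\<^sub>R e \<in> closed_segment x' f'"
    using u(1) in_segment(1)[of _ x e] by auto
  have "t \<noteq> 1" using t(3) u(2) by auto
  have "(1 - t) * side x' f' x + t * side x' f' e = 0"
    using side_segment_eq_0[OF t(3)] by (simp add: side_affine)
  moreover have "(1 - t) * side x' f' x < 0" using Ax t \<open>t \<noteq> 1\<close> by (simp add: mult_less_0_iff)
  ultimately have Ae: "0 < side x' f' e" using t(1) by (smt (verit) mult_nonneg_nonpos)
  obtain s where s: "0 \<le> s" "s \<le> 1" "(1 - s) *\<^sub>R e + s *\<^sub>R f \<in> closed_segment x' f'"
    using w in_segment(1)[of _ e f] by auto
  have "(1 - s) * side x' f' e + s * side x' f' f = 0"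
    using side_segment_eq_0[OF s(3)] by (simp add: side_affine)
  then have Af: "side x' f' f \<le> 0"
    using Ae s by (smt (verit) mult_nonneg_nonneg mult_pos_pos)
  have "(Y f - Y x') / X f \<le> (Y f' - Y x') / X f'"
    using Af pos by (simp add: A field_simps)
  also have "\<dots> < (Y e - Y x') / X e"
    using Ae pos by (simp add: A field_simps)
  finally show ?thesis .
qed

text \<open>\<open>T\<close> and \<open>T'\<close> stand for convex sets containing the triangles
  \<open>x e f\<close> and \<open>x' e' f'\<close>. As neither contains a vertex of the other
  triangle, Pasch's axiom applies to each side of one triangle against the other triangle.\<close>

lemma crossing_triangles_corresponding_sides_meet:
  assumes X: "X x = 0" "X x' = 0" and Y: "Y x < Y x'"
    and pos: "0 < X e" "0 < X f" "0 < X e'" "0 < X f'"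
    and T: "convex T" "x \<in> T" "e \<in> T" "f \<in> T" "x' \<notin> T" "e' \<notin> T" "f' \<notin> T"
    and T': "convex T'" "x' \<in> T'" "e' \<in> T'" "f' \<in> T'" "x \<notin> T'" "e \<notin> T'" "f \<notin> T'"
    and meet: "closed_segment x e \<inter> closed_segment x' f' \<noteq> {}"
  shows "closed_segment x e \<inter> closed_segment x' e' \<noteq> {} \<or>
    closed_segment x f \<inter> closed_segment x' f' \<noteq> {} \<or>
    closed_segment e f \<inter> closed_segment e' f' \<noteq> {}"
proof (rule ccontr)
  assume no: "\<not> ?thesis"
  note cs = closed_segment_commute and pasch = crossing_segment_meets_other_side
  \<comment> \<open>Repeated use of Pasch's axiom leaves only the hexagram configuration, in which \<open>e\<close> and \<open>f\<close>
    would each have to be seen from \<open>x'\<close> under a larger slope than the other.\<close>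
  have 1: "closed_segment x' f' \<inter> closed_segment e f \<noteq> {}"
    using pasch[OF _ T(1) T(2,3,4) T(5,7)] meet no by (metis Int_commute)
  have "closed_segment x e \<inter> closed_segment f' e' \<noteq> {}"
    using pasch[OF _ T'(1) T'(2,4,3) T'(5,6)] meet no by (metis Int_commute)
  then have "closed_segment e' f' \<inter> closed_segment x f \<noteq> {}"
    using pasch[OF _ T(1) T(2,3,4) T(6,7)] no by (metis Int_commute cs)
  then have 2: "closed_segment x f \<inter> closed_segment x' e' \<noteq> {}"
    using pasch[OF _ T'(1) T'(3,4,2) T'(5,7)] no by (metis Int_commute cs)
  then have 3: "closed_segment x' e' \<inter> closed_segment f e \<noteq> {}"
    using pasch[OF _ T(1) T(2,4,3) T(5,6)] no by (metis Int_commute cs)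
  have "e \<notin> closed_segment x' f'" "f \<notin> closed_segment x' e'"
    using T' closed_segment_subset by blast+
  then show False
    using slope_less_of_segment_meeting_two_sides[OF X Y pos(1,2,4) _ _ 1]
      slope_less_of_segment_meeting_two_sides[OF X Y pos(2,1,3) _ _ 3] meet 2 by (simp add: Int_commute)
qed

end

subsection \<open>Pairwise crossing segments in pairwise intersecting sets\<close>

lemma ex_less_3: "(\<exists>k<3. P k) \<longleftrightarrow> P 0 \<or> P 1 \<or> P 2" for P :: "nat \<Rightarrow> bool"
  by (auto simp: numeral_3_eq_3 numeral_2_eq_2 less_Suc_eq)

lemma crossing_segments_of_sets_meeting_a_line:
  fixes M :: nat
  shows "\<exists>m::nat. \<forall>(X :: 'a::real_vector \<Rightarrow> real) Y K x q. planar_chart X Y \<and>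
     (\<forall>i<m. convex (K i) \<and> x i \<in> K i \<and> X (x i) = 0) \<and>
     (\<forall>i<m. \<forall>j<m. i \<noteq> j \<longrightarrow> x i \<notin> K j) \<and>
     (\<forall>j<m. \<forall>i<j. Y (x i) < Y (x j) \<and> q i j \<in> K i \<and> q i j \<in> K j \<and> 0 < X (q i j)) \<and>
     (\<forall>i<m. \<forall>j<m. \<forall>k<m. i \<noteq> j \<and> i \<noteq> k \<and> j \<noteq> k \<longrightarrow> K i \<inter> K j \<inter> K k = {}) \<longrightarrow>
     (\<exists>g a b. (\<forall>i<M. g i < m \<and> a i \<in> K (g i) \<and> b i \<in> K (g i)) \<and>
       (\<forall>j<M. \<forall>i<j. g i < g j \<and> closed_segment (a i) (b i) \<inter> closed_segment (a j) (b j) \<noteq> {}))"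
proof -
  obtain n2 where n2: "\<forall>P :: nat \<Rightarrow> nat \<Rightarrow> nat \<Rightarrow> bool.
    (\<forall>j<n2. \<forall>i<j. \<exists>k<3. P k i j) \<longrightarrow>
    (\<exists>k<3. \<exists>g. (\<forall>i<M. g i < n2) \<and> (\<forall>j<M. \<forall>i<j. g i < g j) \<and>
      (\<forall>j<M. \<forall>i<j. P k (g i) (g j)))"
    using ramsey_increasing_2[where c = 3 and m = M] by (rule exE)
  \<comment> \<open>The first two crossing types consume \<open>2 * M\<close> indices, the third
    \<open>n2\<close> indices between two extreme ones; one length serves all three.\<close>
  define l where "l = n2 + 2 + 2 * M"
  obtain m where m: "\<forall>P :: nat \<Rightarrow> nat \<Rightarrow> nat \<Rightarrow> nat \<Rightarrow> nat \<Rightarrow> bool.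
    (\<forall>i4<m. \<forall>i3<i4. \<forall>i2<i3. \<forall>i1<i2. \<exists>k<3. P k i1 i2 i3 i4) \<longrightarrow>
    (\<exists>k<3. \<exists>g. (\<forall>i<l. g i < m) \<and> (\<forall>j<l. \<forall>i<j. g i < g j) \<and>
      (\<forall>i4<l. \<forall>i3<i4. \<forall>i2<i3. \<forall>i1<i2. P k (g i1) (g i2) (g i3) (g i4)))"
    using ramsey_increasing_4[where c = 3 and m = l] by (rule exE)
  show ?thesis
  proof (rule exI[of _ m], intro allI impI, elim conjE)
    fix X Y :: "'a \<Rightarrow> real" and K x q
    assume chart: "planar_chart X Y"
      and K: "\<forall>i<m. convex (K i) \<and> x i \<in> K i \<and> X (x i) = 0"
      and xK: "\<forall>i<m. \<forall>j<m. i \<noteq> j \<longrightarrow> x i \<notin> K j"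
      and q: "\<forall>j<m. \<forall>i<j. Y (x i) < Y (x j) \<and> q i j \<in> K i \<and> q i j \<in> K j \<and> 0 < X (q i j)"
      and triple: "\<forall>i<m. \<forall>j<m. \<forall>k<m. i \<noteq> j \<and> i \<noteq> k \<and> j \<noteq> k \<longrightarrow> K i \<inter> K j \<inter> K k = {}"
    interpret planar_chart X Y by (rule chart)
    define P where "P k i1 i2 i3 i4 \<longleftrightarrow>
      k = 0 \<and> closed_segment (x i1) (q i1 i3) \<inter> closed_segment (x i2) (q i2 i4) \<noteq> {} \<or>
      k = 1 \<and> closed_segment (x i3) (q i1 i3) \<inter> closed_segment (x i4) (q i2 i4) \<noteq> {} \<or>
      k = 2 \<and> closed_segment (x i2) (q i2 i4) \<inter> closed_segment (x i3) (q i1 i3) \<noteq> {}"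
      for k i1 i2 i3 i4 :: nat
    have "\<forall>i4<m. \<forall>i3<i4. \<forall>i2<i3. \<forall>i1<i2. \<exists>k<3. P k i1 i2 i3 i4"
    proof (intro allI impI)
      fix i1 i2 i3 i4 assume "i4 < m" "i3 < i4" "i2 < i3" "i1 < i2"
      then have "P 0 i1 i2 i3 i4 \<or> P 1 i1 i2 i3 i4 \<or> P 2 i1 i2 i3 i4"
        using interleaved_arcs_cases[of "x i1" "x i2" "x i3" "x i4" "q i1 i3" "q i2 i4"] K q
        by (simp add: P_def)
      then show "\<exists>k<3. P k i1 i2 i3 i4"
        by (simp only: ex_less_3)
    qed
    from m[THEN spec, of P, THEN mp, OF this]
    obtain k g where k: "k < 3" and g: "\<forall>i<l. g i < m" "\<forall>j<l. \<forall>i<j. g i < g j"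
      and Pk: "\<forall>i4<l. \<forall>i3<i4. \<forall>i2<i3. \<forall>i1<i2. P k (g i1) (g i2) (g i3) (g i4)"
      by (elim exE conjE) (rule that)
    from k consider "k = 0" | "k = 1" | "k = 2" by linarith
    then show "\<exists>g a b. (\<forall>i<M. g i < m \<and> a i \<in> K (g i) \<and> b i \<in> K (g i)) \<and>
       (\<forall>j<M. \<forall>i<j. g i < g j \<and> closed_segment (a i) (b i) \<inter> closed_segment (a j) (b j) \<noteq> {})"
    proof cases
      case 1
      \<comment> \<open>Index \<open>i\<close> gets the partner \<open>M + i\<close>: for
        \<open>i < j < M\<close> the quadruple \<open>i, j, M + i, M + j\<close> is increasing, so
        its homogeneous type speaks of exactly the segments wanted.\<close>
      show ?thesis
      proof (rule exI[of _ g], rule exI[of _ "\<lambda>i. x (g i)"],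
          rule exI[of _ "\<lambda>i. q (g i) (g (M + i))"], intro conjI allI impI)
        fix i assume "i < M"
        then show "g i < m" "x (g i) \<in> K (g i)" "q (g i) (g (M + i)) \<in> K (g i)"
          using g K q by (simp_all add: l_def)
      next
        fix i j assume "j < M" "i < j"
        then show "g i < g j" "closed_segment (x (g i)) (q (g i) (g (M + i))) \<inter>
            closed_segment (x (g j)) (q (g j) (g (M + j))) \<noteq> {}"
          using g Pk[rule_format, of "M + j" "M + i" j i] 1 by (simp_all add: l_def P_def)
      qed
    next
      case 2
      \<comment> \<open>The same pairing, with the segments now based at the upper indices
        \<open>M + i\<close>.\<close>
      show ?thesis
      proof (rule exI[of _ "\<lambda>i. g (M + i)"], rule exI[of _ "\<lambda>i. x (g (M + i))"],
          rule exI[of _ "\<lambda>i. q (g i) (g (M + i))"], intro conjI allI impI)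
        fix i assume "i < M"
        then show "g (M + i) < m" "x (g (M + i)) \<in> K (g (M + i))"
            "q (g i) (g (M + i)) \<in> K (g (M + i))"
          using g K q by (simp_all add: l_def)
      next
        fix i j assume "j < M" "i < j"
        then show "g (M + i) < g (M + j)" "closed_segment (x (g (M + i))) (q (g i) (g (M + i))) \<inter>
            closed_segment (x (g (M + j))) (q (g j) (g (M + j))) \<noteq> {}"
          using g Pk[rule_format, of "M + j" "M + i" j i] 2 by (simp_all add: l_def P_def)
      qed
    next
      case 3
      \<comment> \<open>The extreme indices \<open>0\<close> and \<open>Suc n2\<close> become common
        partners of all indices in between, which gives one triangle with vertices
        \<open>x (y i)\<close>, \<open>e i\<close>, \<open>f i\<close> for each
        \<open>i < n2\<close>.\<close>
      define y where "y i = g (Suc i)" for i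
      define e where "e i = q (y i) (g (Suc n2))" for i
      define f where "f i = q (g 0) (y i)" for i
      have y: "g 0 < y i" "y i < g (Suc n2)" "g (Suc n2) < m" "y i < m" "g 0 < m" if "i < n2" for i
        using g that by (simp_all add: y_def l_def)
      have yy: "y i < y j" if "i < j" "j < n2" for i j
        using g that by (simp add: y_def l_def)
      have e: "e i \<in> K (y i)" "e i \<in> K (g (Suc n2))" "0 < X (e i)" if "i < n2" for i
        using q y[OF that] by (simp_all add: e_def)
      have f: "f i \<in> K (y i)" "f i \<in> K (g 0)" "0 < X (f i)" if "i < n2" for i
        using q y[OF that] by (simp_all add: f_def)
      \<comment> \<open>Each \<open>e i\<close> and each \<open>f i\<close> already lies in two
        sets, \<open>K (y i)\<close> and an extreme one, and so in no third.\<close>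
      have notin: "x (y i) \<notin> K (y j)" "e i \<notin> K (y j)" "f i \<notin> K (y j)"
        if ij: "i < n2" "j < n2" "i \<noteq> j" for i j
      proof -
        have ne: "y i \<noteq> y j" using yy[of i j] yy[of j i] ij by (cases i j rule: linorder_cases) auto
        show "x (y i) \<notin> K (y j)" by (rule xK[rule_format]) (use y(4) ij ne in auto)
        have "K (y i) \<inter> K (y j) \<inter> K (g (Suc n2)) = {}"
          by (rule triple[rule_format]) (use y[of i] y[of j] ij ne in auto)
        then show "e i \<notin> K (y j)" using e[of i] ij by blast
        have "K (y i) \<inter> K (y j) \<inter> K (g 0) = {}"
          by (rule triple[rule_format]) (use y[of i] y[of j] ij ne in auto)
        then show "f i \<notin> K (y j)" using f[of i] ij by blast
      qed
      define Q where "Q k i j \<longleftrightarrow>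
        k = 0 \<and> closed_segment (x (y i)) (e i) \<inter> closed_segment (x (y j)) (e j) \<noteq> {} \<or>
        k = 1 \<and> closed_segment (x (y i)) (f i) \<inter> closed_segment (x (y j)) (f j) \<noteq> {} \<or>
        k = 2 \<and> closed_segment (e i) (f i) \<inter> closed_segment (e j) (f j) \<noteq> {}" for k i j :: nat
      have "\<forall>j<n2. \<forall>i<j. \<exists>k<3. Q k i j"
      proof (intro allI impI)
        fix i j assume j: "j < n2" and ij: "i < j"
        then have i: "i < n2" by simp
        \<comment> \<open>This is the third crossing type for the quadruple
          \<open>0, Suc i, Suc j, Suc n2\<close>.\<close>
        have meet: "closed_segment (x (y i)) (e i) \<inter> closed_segment (x (y j)) (f j) \<noteq> {}"
          using Pk[rule_format, of "Suc n2" "Suc j" "Suc i" 0] 3 i j ij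
          by (simp add: P_def y_def e_def f_def l_def)
        have "X (x (y i)) = 0" "X (x (y j)) = 0" "Y (x (y i)) < Y (x (y j))"
          using K q y[OF i] y[OF j] yy[OF ij j] by auto
        then have "closed_segment (x (y i)) (e i) \<inter> closed_segment (x (y j)) (e j) \<noteq> {} \<or>
          closed_segment (x (y i)) (f i) \<inter> closed_segment (x (y j)) (f j) \<noteq> {} \<or>
          closed_segment (e i) (f i) \<inter> closed_segment (e j) (f j) \<noteq> {}"
          by (rule crossing_triangles_corresponding_sides_meet[where T = "K (y i)" and T' = "K (y j)"])
            (use K y(4)[OF i] y(4)[OF j] e[OF i] e[OF j] f[OF i] f[OF j]
              notin[OF i j] notin[OF j i] ij meet in simp_all)
        then have "Q 0 i j \<or> Q 1 i j \<or> Q 2 i j" by (simp add: Q_def)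
        then show "\<exists>k<3. Q k i j"
          by (simp only: ex_less_3)
      qed
      from n2[THEN spec, of Q, THEN mp, OF this]
      obtain k' h where k': "k' < 3" and h: "\<forall>i<M. h i < n2" "\<forall>j<M. \<forall>i<j. h i < h j"
        and Qk: "\<forall>j<M. \<forall>i<j. Q k' (h i) (h j)"
        by (elim exE conjE) (rule that)
      \<comment> \<open>The colour names the side of the triangle: 0 for \<open>x e\<close>, 1 for
        \<open>x f\<close>, 2 for \<open>e f\<close>.\<close>
      define a where "a i = (if k' = 2 then e (h i) else x (y (h i)))" for i
      define b where "b i = (if k' = 0 then e (h i) else f (h i))" for i
      show ?thesis
      proof (rule exI[of _ "\<lambda>i. y (h i)"], rule exI[of _ a], rule exI[of _ b], intro conjI allI impI)
        fix i assume "i < M"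
        then show "y (h i) < m" "a i \<in> K (y (h i))" "b i \<in> K (y (h i))"
          using h y e f K by (auto simp: a_def b_def)
      next
        fix i j assume "j < M" "i < j"
        then show "y (h i) < y (h j)" "closed_segment (a i) (b i) \<inter> closed_segment (a j) (b j) \<noteq> {}"
          using h yy Qk[rule_format, of j i] by (auto simp: Q_def a_def b_def)
      qed
    qed
  qed
qed

section \<open>Collinear intersection points and a common vertical transversal\<close>

text \<open>One of three collinear points lies between the other two. Those two share one of the
  sets, which by convexity contains the middle point as well, making it common to all three
  sets.\<close>

lemma not_collinear_pairwise_intersections:
  fixes A B C :: "'a::euclidean_space set"
  assumes "convex A" "convex B" "convex C" "A \<inter> B \<inter> C = {}"
    and "p \<in> A \<inter> B" "q \<in> B \<inter> C" "r \<in> A \<inter> C"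
  shows "\<not> collinear {p, q, r}"
proof
  assume "collinear {p, q, r}"
  then consider "p \<in> closed_segment q r" | "q \<in> closed_segment r p" | "r \<in> closed_segment p q"
    by (auto simp: collinear_between_cases between_mem_segment)
  then show False
  proof cases
    case 1
    then have "p \<in> C" using assms closed_segment_subset[of q C r] by blast
    then show ?thesis using assms by blast
  next
    case 2
    then have "q \<in> A" using assms closed_segment_subset[of r A p] by blast
    then show ?thesis using assms by blast
  next
    case 3
    then have "r \<in> B" using assms closed_segment_subset[of p B q] by blast
    then show ?thesis using assms by blast
  qed
qed

lemma collinear_vertical:
  fixes S :: "(real^2) set"
  assumes "\<And>p. p \<in> S \<Longrightarrow> p $ 1 = c"
  shows "collinear S"
  unfolding collinear_def
proof (intro exI ballI)
  fix p q assume "p \<in> S" "q \<in> S"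
  then show "p - q = (p $ 2 - q $ 2) *\<^sub>R axis 2 1"
    using assms by (simp add: vec_eq_iff forall_2 axis_def)
qed

lemma collinear_graph:
  fixes S :: "(real^2) set"
  assumes "\<And>p. p \<in> S \<Longrightarrow> p $ 2 = m * p $ 1 + c"
  shows "collinear S"
  unfolding collinear_def
proof (intro exI ballI)
  fix p q assume "p \<in> S" "q \<in> S"
  then show "p - q = (p $ 1 - q $ 1) *\<^sub>R vector [1, m]"
    using assms by (simp add: vec_eq_iff forall_2 algebra_simps)
qed

text \<open>The projections to the first coordinate are pairwise intersecting convex subsets of the
  real line, so Helly's theorem in dimension one applies.\<close>

lemma common_vertical_line:
  fixes F :: "(real^2) set set"
  assumes "2 \<le> card F" "\<And>A. A \<in> F \<Longrightarrow> convex A"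
    and meet: "\<And>A B. A \<in> F \<Longrightarrow> B \<in> F \<Longrightarrow> A \<noteq> B \<Longrightarrow> A \<inter> B \<noteq> {}"
  obtains c where "\<And>A. A \<in> F \<Longrightarrow> \<exists>p\<in>A. p $ 1 = c"
proof -
  define f where "f A = (\<lambda>p. p $ 1) ` A" for A :: "(real^2) set"
  have fin: "finite F" using assms(1) card.infinite by fastforce
  have ne: "A \<noteq> {}" if "A \<in> F" for A
  proof -
    have "\<exists>B\<in>F. B \<noteq> A" 
      using assms(1) that by (metis card_2_iff' fin obtain_subset_with_card_n subset_iff)
    with meet that show ?thesis by blast
  qed
  have "\<Inter> (f ` F) \<noteq> {}"
  \<comment> \<open>Distinct sets may have the same projection; Helly's theorem asks for two
    distinct ones, so a single projection is treated apart.\<close>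
  proof (cases "2 \<le> card (f ` F)")
    case True
    show ?thesis
    proof (rule Helly)
      show "card (f ` F) \<ge> DIM(real) + 1" using True by simp
      show "\<forall>s\<in>f ` F. convex s"
        using assms(2) by (auto simp: f_def intro!: convex_linear_image linearI)
      fix t assume "t \<subseteq> f ` F" "card t = DIM(real) + 1"
      moreover from this obtain U V where "t = {U, V}" "U \<noteq> V"
        by (auto simp: card_2_iff simp flip: numeral_2_eq_2)
      ultimately obtain A B where "A \<in> F" "B \<in> F" "t = {f A, f B}" "A \<noteq> B" by auto
      with meet[of A B] show "\<Inter> t \<noteq> {}" by (auto simp: f_def)
    qed
  next
    case False
    obtain A where A: "A \<in> F" using assms(1) by fastforce
    have "f ` F \<subseteq> {f A}"
    proof (rule ccontr)
      assume "\<not> f ` F \<subseteq> {f A}"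
      then obtain B where "B \<in> F" "f B \<noteq> f A" by auto
      then have "card {f A, f B} \<le> card (f ` F)" using A fin by (intro card_mono) auto
      with False \<open>f B \<noteq> f A\<close> show False by simp
    qed
    then have "f ` F = {f A}" using A by blast
    with ne[OF A] show ?thesis by (simp add: f_def)
  qed
  then obtain c where "\<forall>A\<in>F. c \<in> f A" by auto
  then show ?thesis by (intro that[of c]) (auto simp: f_def)
qed

lemma planar_chart_vertical_line:
  fixes c s :: real
  assumes "s \<noteq> 0"
  shows "planar_chart (\<lambda>p :: real^2. s * (p $ 1 - c)) (\<lambda>p. p $ 2)"
  using assms by unfold_locales (auto simp: algebra_simps vec_eq_iff forall_2)

lemma crossing_segments:
  fixes M :: nat
  shows "\<exists>N. \<forall>F. strictly_2_intersecting F \<and> N \<le> card F \<longrightarrow>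
    (\<exists>K a b. inj_on K {..<M} \<and> K ` {..<M} \<subseteq> F \<and> (\<forall>i<M. a i \<in> K i \<and> b i \<in> K i) \<and>
      (\<forall>j<M. \<forall>i<j. closed_segment (a i) (b i) \<inter> closed_segment (a j) (b j) \<noteq> {}))"
proof -
  obtain m :: nat where m: "\<forall>(X :: real^2 \<Rightarrow> real) Y K x q. planar_chart X Y \<and>
     (\<forall>i<m. convex (K i) \<and> x i \<in> K i \<and> X (x i) = 0) \<and>
     (\<forall>i<m. \<forall>j<m. i \<noteq> j \<longrightarrow> x i \<notin> K j) \<and>
     (\<forall>j<m. \<forall>i<j. Y (x i) < Y (x j) \<and> q i j \<in> K i \<and> q i j \<in> K j \<and> 0 < X (q i j)) \<and>
     (\<forall>i<m. \<forall>j<m. \<forall>k<m. i \<noteq> j \<and> i \<noteq> k \<and> j \<noteq> k \<longrightarrow> K i \<inter> K j \<inter> K k = {}) \<longrightarrow>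
     (\<exists>g a b. (\<forall>i<M. g i < m \<and> a i \<in> K (g i) \<and> b i \<in> K (g i)) \<and>
       (\<forall>j<M. \<forall>i<j. g i < g j \<and> closed_segment (a i) (b i) \<inter> closed_segment (a j) (b j) \<noteq> {}))"
    using crossing_segments_of_sets_meeting_a_line[where M = M and 'a = "real^2"] by (rule exE)
  \<comment> \<open>The three spare indices ensure that a triple is available to refute the first
    type below, however small \<open>m\<close> is.\<close>
  obtain N where N: "\<forall>P :: nat \<Rightarrow> nat \<Rightarrow> nat \<Rightarrow> bool.
    (\<forall>j<N. \<forall>i<j. \<exists>k<3. P k i j) \<longrightarrow>
    (\<exists>k<3. \<exists>g. (\<forall>i<m + 3. g i < N) \<and> (\<forall>j<m + 3. \<forall>i<j. g i < g j) \<and>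
      (\<forall>j<m + 3. \<forall>i<j. P k (g i) (g j)))"
    using ramsey_increasing_2[where c = 3 and m = "m + 3"] by (rule exE)
  show ?thesis
  \<comment> \<open>Adding 2 guarantees the two sets that the transversal line requires.\<close>
  proof (rule exI[of _ "N + 2"], intro allI impI, elim conjE)
    fix F :: "(real^2) set set"
    assume F: "strictly_2_intersecting F" and card: "N + 2 \<le> card F"
    have fin: "finite F" and conv: "\<And>A. A \<in> F \<Longrightarrow> convex A"
      and meet: "\<And>A B. A \<in> F \<Longrightarrow> B \<in> F \<Longrightarrow> A \<noteq> B \<Longrightarrow> A \<inter> B \<noteq> {}"
      and triple: "\<And>A B C. A \<in> F \<Longrightarrow> B \<in> F \<Longrightarrow> C \<in> F \<Longrightarrow> A \<noteq> B \<Longrightarrow> A \<noteq> C \<Longrightarrow> B \<noteq> C \<Longrightarrow>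
        A \<inter> B \<inter> C = {}"
      using F unfolding strictly_2_intersecting_def by auto
    obtain c where c: "\<And>A. A \<in> F \<Longrightarrow> \<exists>p\<in>A. p $ 1 = c"
      using common_vertical_line[of F] card conv meet by force
    obtain K where K: "bij_betw K {0..<card F} F" using ex_bij_betw_nat_finite[OF fin] by blast
    have KF: "K i \<in> F" if "i < N" for i
      using that card bij_betwE[OF K] by auto
    have Kne: "K i \<noteq> K j" if "i < j" "j < N" for i j
      using that card inj_onD[OF bij_betw_imp_inj_on[OF K], of i j] by auto
    \<comment> \<open>The types are: meeting on the line; meeting only off it, with a point to the
      right; the same with a point to the left. Excluding the line in the last two types is what
      later keeps each chosen point on the line out of all other sets.\<close>
    define P where "P k i j \<longleftrightarrow>
      k = 0 \<and> (\<exists>p\<in>K i \<inter> K j. p $ 1 = c) \<or>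
      k = 1 \<and> (\<forall>p\<in>K i \<inter> K j. p $ 1 \<noteq> c) \<and> (\<exists>p\<in>K i \<inter> K j. 0 < p $ 1 - c) \<or>
      k = 2 \<and> (\<forall>p\<in>K i \<inter> K j. p $ 1 \<noteq> c) \<and> (\<exists>p\<in>K i \<inter> K j. 0 < - (p $ 1 - c))" for k i j :: nat
    have "\<forall>j<N. \<forall>i<j. \<exists>k<3. P k i j"
    proof (intro allI impI)
      fix i j assume ij: "j < N" "i < j"
      then obtain p where p: "p \<in> K i \<inter> K j" using meet[of "K i" "K j"] KF Kne by fastforce
      have "P 0 i j \<or> P 1 i j \<or> P 2 i j"
        using p by (cases "p $ 1" c rule: linorder_cases) (auto simp: P_def)
      then show "\<exists>k<3. P k i j"
        by (simp only: ex_less_3)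
    qed
    from N[THEN spec, of P, THEN mp, OF this]
    obtain k g where k: "k < 3" and g: "\<forall>i<m + 3. g i < N" "\<forall>j<m + 3. \<forall>i<j. g i < g j"
      and Pk: "\<forall>j<m + 3. \<forall>i<j. P k (g i) (g j)"
      by (elim exE conjE) (rule that)
    \<comment> \<open>Three sets meeting pairwise on one vertical line would have collinear
      intersection points.\<close>
    have "k \<noteq> 0"
    proof
      assume "k = 0"
      then have "P 0 (g 0) (g 1)" "P 0 (g 1) (g 2)" "P 0 (g 0) (g 2)" using Pk by auto
      then obtain p q r where pqr: "p \<in> K (g 0) \<inter> K (g 1)" "q \<in> K (g 1) \<inter> K (g 2)"
        "r \<in> K (g 0) \<inter> K (g 2)" and "p $ 1 = c" "q $ 1 = c" "r $ 1 = c"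
        by (auto simp: P_def)
      then have "collinear {p, q, r}" by (intro collinear_vertical) auto
      moreover have "\<not> collinear {p, q, r}"
        using g by (intro not_collinear_pairwise_intersections[OF _ _ _ _ pqr] conv triple KF Kne) auto
      ultimately show False by simp
    qed
    define s :: real where "s = (if k = 1 then 1 else -1)"
    \<comment> \<open>The order found by Ramsey's theorem is dropped: the type of a pair is
      symmetric in its two sets, so they can be enumerated afresh by height on the line.\<close>
    define S where "S = (\<lambda>i. K (g i)) ` {..<m}"
    have gg: "g i < g j" "g j < N" if "i < j" "j < m" for i j using that g by auto
    have "inj_on (\<lambda>i. K (g i)) {..<m}"
      using Kne gg by (intro linorder_inj_onI) auto
    then have cardS: "card S = m" by (simp add: S_def card_image)
    have SF: "S \<subseteq> F" using KF g by (auto simp: S_def)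
    have S: "(\<forall>p\<in>A \<inter> B. p $ 1 \<noteq> c) \<and> (\<exists>p\<in>A \<inter> B. 0 < s * (p $ 1 - c))"
      if AB: "A \<in> S" "B \<in> S" "A \<noteq> B" for A B
    proof -
      obtain i j where ij: "i < m" "j < m" "A = K (g i)" "B = K (g j)" "i \<noteq> j"
        using AB by (auto simp: S_def)
      then have "P k (g i) (g j) \<or> P k (g j) (g i)" using Pk by (cases i j rule: linorder_cases) auto
      then show ?thesis using ij k \<open>k \<noteq> 0\<close> by (auto simp: P_def s_def Int_commute)
    qed
    define x where "x A = (SOME p. p \<in> A \<and> p $ 1 = c)" for A :: "(real^2) set"
    have x: "x A \<in> A \<and> x A $ 1 = c" if "A \<in> S" for A
      unfolding x_def by (rule someI_ex) (use c SF that in blast)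
    \<comment> \<open>Points of equal height on the line coincide, and then two sets would meet on
      it.\<close>
    have "inj_on (\<lambda>A. x A $ 2) S"
    proof (rule inj_onI, rule ccontr)
      fix A B assume AB: "A \<in> S" "B \<in> S" "x A $ 2 = x B $ 2" "A \<noteq> B"
      then have "x A = x B" using x by (simp add: vec_eq_iff forall_2)
      with AB x S[of A B] show False by (metis IntI)
    qed
    moreover have "finite S" by (simp add: S_def)
    ultimately obtain h where h: "bij_betw h {..<m} S"
      and hx: "\<And>i j. i < j \<Longrightarrow> j < m \<Longrightarrow> x (h i) $ 2 < x (h j) $ 2"
      using finite_enumerate_by_key[of S "\<lambda>A. x A $ 2"] cardS by auto
    have hS: "h i \<in> S" if "i < m" for i using that h bij_betwE by blast
    have hne: "h i \<noteq> h j" if "i < m" "j < m" "i \<noteq> j" for i j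
      using that h by (auto simp: bij_betw_def inj_on_def)
    define q where "q i j = (SOME p. p \<in> h i \<inter> h j \<and> 0 < s * (p $ 1 - c))" for i j
    have q: "q i j \<in> h i \<inter> h j \<and> 0 < s * (q i j $ 1 - c)" if "i < m" "j < m" "i \<noteq> j" for i j
      unfolding q_def by (rule someI_ex) (use S[of "h i" "h j"] hS hne that in blast)
    have "\<exists>g a b. (\<forall>i<M. g i < m \<and> a i \<in> h (g i) \<and> b i \<in> h (g i)) \<and>
       (\<forall>j<M. \<forall>i<j. g i < g j \<and> closed_segment (a i) (b i) \<inter> closed_segment (a j) (b j) \<noteq> {})"
    proof (rule m[rule_format, of "\<lambda>p. s * (p $ 1 - c)" "\<lambda>p. p $ 2" h "\<lambda>i. x (h i)" q],
        intro conjI allI impI)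
      show "planar_chart (\<lambda>p :: real^2. s * (p $ 1 - c)) (\<lambda>p. p $ 2)"
        by (rule planar_chart_vertical_line) (simp add: s_def)
    next
      fix i assume "i < m"
      then show "convex (h i)" "x (h i) \<in> h i" "s * (x (h i) $ 1 - c) = 0"
        using hS[of i] SF conv x by auto
    next
      fix i j assume "i < m" "j < m" "i \<noteq> j"
      then show "x (h i) \<notin> h j" using S[of "h i" "h j"] hS hne x by blast
    next
      fix i j assume ij: "j < m" "i < j"
      then show "x (h i) $ 2 < x (h j) $ 2" "q i j \<in> h i" "q i j \<in> h j" "0 < s * (q i j $ 1 - c)"
        using hx q[of i j] by auto
    next
      fix i j k assume "i < m" "j < m" "k < m" "i \<noteq> j \<and> i \<noteq> k \<and> j \<noteq> k"
      then show "h i \<inter> h j \<inter> h k = {}" using hS SF hne by (intro triple) auto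
    qed
    then obtain g a b where g: "\<forall>i<M. g i < m \<and> a i \<in> h (g i) \<and> b i \<in> h (g i)"
      and ab: "\<forall>j<M. \<forall>i<j. g i < g j \<and> closed_segment (a i) (b i) \<inter> closed_segment (a j) (b j) \<noteq> {}"
      by blast
    have "inj_on (\<lambda>i. h (g i)) {..<M}"
      using hne g ab by (intro linorder_inj_onI) (auto, metis less_irrefl less_trans)
    moreover have "(\<lambda>i. h (g i)) ` {..<M} \<subseteq> F" using hS SF g by auto
    ultimately show "\<exists>K a b. inj_on K {..<M} \<and> K ` {..<M} \<subseteq> F \<and> (\<forall>i<M. a i \<in> K i \<and> b i \<in> K i) \<and>
      (\<forall>j<M. \<forall>i<j. closed_segment (a i) (b i) \<inter> closed_segment (a j) (b j) \<noteq> {})"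
      using g ab by blast
  qed
qed

subsection \<open>Caps and cups of lines\<close>

definition graph_line :: "real \<Rightarrow> real \<Rightarrow> (real^2) set" where
  "graph_line m c = {p. p $ 2 = m * p $ 1 + c}"

lemma is_line_graph_line: "is_line (graph_line m c)"
proof -
  define p q :: "real^2" where "p = vector [0, c]" and "q = vector [1, m + c]"
  have "graph_line m c = affine hull {p, q}"
  proof (intro set_eqI iffI)
    fix z assume "z \<in> graph_line m c"
    then have "z = p + z $ 1 *\<^sub>R (q - p)"
      by (simp add: graph_line_def p_def q_def vec_eq_iff forall_2)
    then show "z \<in> affine hull {p, q}" unfolding affine_hull_2_alt by blast
  next
    fix z assume "z \<in> affine hull {p, q}"
    then obtain u where "z = p + u *\<^sub>R (q - p)" unfolding affine_hull_2_alt by blast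
    then show "z \<in> graph_line m c" by (simp add: graph_line_def p_def q_def)
  qed
  moreover have "p \<noteq> q" by (simp add: p_def q_def vec_eq_iff forall_2)
  ultimately show ?thesis by (simp add: is_line_def aff_dim_2)
qed

lemma nonvertical_graph_line: "nonvertical_line (graph_line m c)"
proof -
  have "graph_line m c \<noteq> {p. p $ 1 = d}" for d
  proof
    assume "graph_line m c = {p. p $ 1 = d}"
    moreover have "vector [d, m * d + c + 1] \<in> {p :: real^2. p $ 1 = d}" by simp
    ultimately have "vector [d, m * d + c + 1] \<in> graph_line m c" by blast
    then show False by (simp add: graph_line_def)
  qed
  then show ?thesis by (simp add: nonvertical_line_def is_line_graph_line)
qed

lemma line_slope_graph_line: "line_slope (graph_line m c) = m"
  unfolding line_slope_def
proof (rule the_equality)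
  show "\<forall>p\<in>graph_line m c. \<forall>q\<in>graph_line m c. q $ 2 - p $ 2 = m * (q $ 1 - p $ 1)"
    by (simp add: graph_line_def algebra_simps)
next
  fix k assume k: "\<forall>p\<in>graph_line m c. \<forall>q\<in>graph_line m c. q $ 2 - p $ 2 = k * (q $ 1 - p $ 1)"
  have "vector [0, c] \<in> graph_line m c" "vector [1, m + c] \<in> graph_line m c"
    by (simp_all add: graph_line_def)
  with k show "k = m" by fastforce
qed

lemma above_graph_line: "above_line p (graph_line m c) \<longleftrightarrow> m * p $ 1 + c < p $ 2"
  unfolding above_line_def graph_line_def
  by (auto intro!: exI[of _ "vector [p $ 1, m * p $ 1 + c]"])

lemma below_graph_line: "below_line p (graph_line m c) \<longleftrightarrow> p $ 2 < m * p $ 1 + c"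
  unfolding below_line_def graph_line_def
  by (auto intro!: exI[of _ "vector [p $ 1, m * p $ 1 + c]"])

lemma graph_line_Int:
  fixes m m' c c' :: real
  assumes "m \<noteq> m'"
  defines "x \<equiv> (c' - c) / (m - m')"
  shows "graph_line m c \<inter> graph_line m' c' = {vector [x, m * x + c]}"
proof -
  have x: "x * (m - m') = c' - c" using assms by simp
  show ?thesis
  proof (intro equalityI subsetI)
    fix p assume p: "p \<in> graph_line m c \<inter> graph_line m' c'"
    then have "p $ 1 * (m - m') = c' - c" by (simp add: graph_line_def algebra_simps)
    then have "p $ 1 = x" using assms by (simp add: eq_divide_eq)
    then show "p \<in> {vector [x, m * x + c]}"
      using p by (simp add: graph_line_def vec_eq_iff forall_2)
  next
    have "m * x + c = m' * x + c'" using x by (simp add: algebra_simps)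
    then show "p \<in> graph_line m c \<inter> graph_line m' c'" if "p \<in> {vector [x, m * x + c]}" for p
      using that by (simp add: graph_line_def)
  qed
qed

text \<open>The quotient is the abscissa at which lines \<open>i\<close> and \<open>k\<close> cross.
  Strictness of the inequality there also rules out concurrency with line \<open>j\<close>.\<close>

lemma n_cap_graph_line:
  assumes dec: "\<And>i j. 1 \<le> i \<Longrightarrow> i < j \<Longrightarrow> j \<le> n \<Longrightarrow> m j < m i"
    and above: "\<And>i j k. 1 \<le> i \<Longrightarrow> i < j \<Longrightarrow> j < k \<Longrightarrow> k \<le> n \<Longrightarrow>
      m j * ((c k - c i) / (m i - m k)) + c j < m i * ((c k - c i) / (m i - m k)) + c i"
  shows "n_cap n (\<lambda>i. graph_line (m i) (c i))"
proof -
  have Int: "\<exists>p. graph_line (m i) (c i) \<inter> graph_line (m k) (c k) = {p} \<and>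
      above_line p (graph_line (m j) (c j))" if "1 \<le> i" "i < j" "j < k" "k \<le> n" for i j k
    using dec[of i k] above[of i j k] that
    by (intro exI conjI, subst graph_line_Int) (auto simp: above_graph_line)
  moreover have "graph_line (m i) (c i) \<inter> graph_line (m j) (c j) \<inter> graph_line (m k) (c k) = {}"
    if ijk: "1 \<le> i" "i < j" "j < k" "k \<le> n" for i j k
  proof -
    obtain p where p: "graph_line (m i) (c i) \<inter> graph_line (m k) (c k) = {p}"
      "above_line p (graph_line (m j) (c j))" using Int[OF ijk] by blast
    then have "{p} \<inter> graph_line (m j) (c j) = {}"
      unfolding above_graph_line by (simp add: graph_line_def)
    with p(1) show ?thesis by (metis Int_assoc Int_commute)
  qed
  ultimately show ?thesis
    using dec by (simp add: n_cap_def nonvertical_graph_line line_slope_graph_line)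
qed

text \<open>The crossing point is computed from line \<open>k\<close> instead of line
  \<open>i\<close>, which is the form that arises when a sequence with decreasing slopes is
  reversed.\<close>

lemma n_cup_graph_line:
  assumes inc: "\<And>i j. 1 \<le> i \<Longrightarrow> i < j \<Longrightarrow> j \<le> n \<Longrightarrow> m i < m j"
    and below: "\<And>i j k. 1 \<le> i \<Longrightarrow> i < j \<Longrightarrow> j < k \<Longrightarrow> k \<le> n \<Longrightarrow>
      m k * ((c i - c k) / (m k - m i)) + c k < m j * ((c i - c k) / (m k - m i)) + c j"
  shows "n_cup n (\<lambda>i. graph_line (m i) (c i))"
proof -
  have Int: "\<exists>p. graph_line (m i) (c i) \<inter> graph_line (m k) (c k) = {p} \<and>
      below_line p (graph_line (m j) (c j))" if "1 \<le> i" "i < j" "j < k" "k \<le> n" for i j k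
    using inc[of i k] below[of i j k] that
    by (subst Int_commute, intro exI conjI, subst graph_line_Int) (auto simp: below_graph_line)
  moreover have "graph_line (m i) (c i) \<inter> graph_line (m j) (c j) \<inter> graph_line (m k) (c k) = {}"
    if ijk: "1 \<le> i" "i < j" "j < k" "k \<le> n" for i j k
  proof -
    obtain p where p: "graph_line (m i) (c i) \<inter> graph_line (m k) (c k) = {p}"
      "below_line p (graph_line (m j) (c j))" using Int[OF ijk] by blast
    then have "{p} \<inter> graph_line (m j) (c j) = {}"
      unfolding below_graph_line by (simp add: graph_line_def)
    with p(1) show ?thesis by (metis Int_assoc Int_commute)
  qed
  ultimately show ?thesis
    using inc by (simp add: n_cup_def nonvertical_graph_line line_slope_graph_line)
qed

section \<open>From crossing segments to lines with distinct slopes\<close>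

lemma segment_on_graph_line:
  fixes a b :: "real^2"
  assumes "a $ 1 \<noteq> b $ 1"
  defines "m \<equiv> (b $ 2 - a $ 2) / (b $ 1 - a $ 1)"
  shows "closed_segment a b \<subseteq> graph_line m (a $ 2 - m * a $ 1)"
proof
  fix z assume "z \<in> closed_segment a b"
  then obtain u where z: "z = (1 - u) *\<^sub>R a + u *\<^sub>R b" by (auto simp: in_segment)
  have "z $ 2 - a $ 2 = u * (b $ 2 - a $ 2)" by (simp add: z algebra_simps)
  also have "b $ 2 - a $ 2 = m * (b $ 1 - a $ 1)" using assms by simp
  also have "u * \<dots> = m * (z $ 1 - a $ 1)" by (simp add: z algebra_simps)
  finally show "z \<in> graph_line m (a $ 2 - m * a $ 1)"
    by (simp add: graph_line_def algebra_simps)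
qed

text \<open>If two of the segments lay on one line, their common point and their meeting points with
  a third segment would be collinear. Hence at most one segment is vertical or degenerate, and since
  crossing segments of equal slope share their line, all other slopes differ and can be
  sorted.\<close>

lemma lines_of_crossing_segments:
  fixes K :: "nat \<Rightarrow> (real^2) set" and M N :: nat
  assumes F: "strictly_2_intersecting F" and inj: "inj_on K {..<M}" and KF: "K ` {..<M} \<subseteq> F"
    and ab: "\<And>i. i < M \<Longrightarrow> a i \<in> K i \<and> b i \<in> K i"
    and meet: "\<And>i j. j < M \<Longrightarrow> i < j \<Longrightarrow> closed_segment (a i) (b i) \<inter> closed_segment (a j) (b j) \<noteq> {}"
    and M: "N + 3 \<le> M"
  obtains h m c where "\<And>i. i < N \<Longrightarrow> h i < M" "inj_on h {..<N}"
    "\<And>i j. j < N \<Longrightarrow> i < j \<Longrightarrow> m j < m i"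
    "\<And>i j. i < N \<Longrightarrow> j < N \<Longrightarrow> i \<noteq> j \<Longrightarrow>
      (K (h i) \<inter> graph_line (m i) (c i)) \<inter> (K (h j) \<inter> graph_line (m j) (c j)) \<noteq> {}"
proof -
  define s where "s i = closed_segment (a i) (b i)" for i
  have conv: "convex (K i)" if "i < M" for i
    using F KF that by (auto simp: strictly_2_intersecting_def)
  have sK: "s i \<subseteq> K i" if "i < M" for i
    using ab conv that by (simp add: s_def closed_segment_subset)
  have smeet: "s i \<inter> s j \<noteq> {}" if "i < M" "j < M" "i \<noteq> j" for i j
    using meet[of i j] meet[of j i] that by (cases i j rule: linorder_cases) (auto simp: s_def)
  have triple: "K i \<inter> K j \<inter> K k = {}" if "i < M" "j < M" "k < M" "i \<noteq> j" "i \<noteq> k" "j \<noteq> k" for i j k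
  proof -
    have "K i \<noteq> K j" "K i \<noteq> K k" "K j \<noteq> K k" using inj that by (auto simp: inj_on_def)
    moreover have "K i \<in> F" "K j \<in> F" "K k \<in> F" using KF that by auto
    ultimately show ?thesis using F unfolding strictly_2_intersecting_def by blast
  qed
  \<comment> \<open>\<open>R\<close> abstracts the equation of a line, so that vertical lines and
    graphs are handled together.\<close>
  have no_common_line: False
    if ij: "i < M" "j < M" "i \<noteq> j" and R: "\<And>z. z \<in> s i \<union> s j \<Longrightarrow> R z"
      "\<And>S. (\<And>z. z \<in> S \<Longrightarrow> R z) \<Longrightarrow> collinear S" for i j R
  proof -
    have "\<exists>k<M. k \<noteq> i \<and> k \<noteq> j"
    proof -
      have "\<not> {..<M} \<subseteq> {i, j}"
        using card_mono[of "{i, j}" "{..<M}"] M ij(3) by auto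
      then show ?thesis by auto
    qed
    then obtain k where k: "k < M" "k \<noteq> i" "k \<noteq> j" by blast
    obtain p q r where pqr: "p \<in> s i \<inter> s j" "q \<in> s j \<inter> s k" "r \<in> s i \<inter> s k"
      using smeet[of i j] smeet[of j k] smeet[of i k] ij k by blast
    have "collinear {p, q, r}" using pqr R(1) by (intro R(2)) blast
    moreover have "\<not> collinear {p, q, r}"
      by (rule not_collinear_pairwise_intersections[of "K i" "K j" "K k"])
        (use conv triple ij k pqr sK[of i] sK[of j] sK[of k] in auto)
    ultimately show False by simp
  qed
  define S where "S = {i. i < M \<and> a i $ 1 \<noteq> b i $ 1}"
  define m c where "m i = (b i $ 2 - a i $ 2) / (b i $ 1 - a i $ 1)"
    and "c i = a i $ 2 - m i * a i $ 1" for i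
  have SM: "i < M" if "i \<in> S" for i using that by (simp add: S_def)
  have vert: "z $ 1 = a i $ 1" if "i < M" "i \<notin> S" "z \<in> s i" for i z
    using that by (auto simp: S_def s_def in_segment) (simp add: algebra_simps)
  have "i = j" if ij: "i < M" "j < M" "i \<notin> S" "j \<notin> S" for i j
  proof (rule ccontr)
    assume "i \<noteq> j"
    obtain p where p: "p \<in> s i" "p \<in> s j" using smeet[of i j] ij \<open>i \<noteq> j\<close> by blast
    then have "z $ 1 = p $ 1" if "z \<in> s i \<union> s j" for z
      using that vert[of i] vert[of j] ij by (metis UnE)
    then show False
      using no_common_line[of i j "\<lambda>z. z $ 1 = p $ 1"] collinear_vertical[of _ "p $ 1"] ij \<open>i \<noteq> j\<close>
      by blast
  qed
  then have "card ({..<M} - S) \<le> 1"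
    by (intro card_le_Suc0_iff_eq[THEN iffD2, folded One_nat_def]) auto
  moreover have finS: "finite S" and "S \<subseteq> {..<M}" by (auto simp: S_def)
  then have "card ({..<M} - S) = M - card S" by (simp add: card_Diff_subset)
  ultimately have cardS: "N \<le> card S" using M by simp
  have line: "s i \<subseteq> graph_line (m i) (c i)" if "i \<in> S" for i
    using segment_on_graph_line[of "a i" "b i"] that by (simp add: S_def s_def m_def c_def)
  \<comment> \<open>The key is negated because the slopes are to decrease.\<close>
  have "inj_on (\<lambda>i. - m i) S"
  proof (rule inj_onI, rule ccontr)
    fix i j assume ij: "i \<in> S" "j \<in> S" "- m i = - m j" "i \<noteq> j"
    obtain p where p: "p \<in> s i \<inter> s j" using smeet[of i j] SM ij by blast
    then have "p \<in> graph_line (m i) (c i)" "p \<in> graph_line (m j) (c j)"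
      using line ij by blast+
    then have "c i = c j" using ij(3) by (simp add: graph_line_def)
    then have "z \<in> graph_line (m i) (c i)" if "z \<in> s i \<union> s j" for z
      using that ij(3) line[OF ij(1)] line[OF ij(2)] by auto
    then have "z $ 2 = m i * z $ 1 + c i" if "z \<in> s i \<union> s j" for z
      using that by (simp add: graph_line_def)
    then show False
      using no_common_line[of i j "\<lambda>z. z $ 2 = m i * z $ 1 + c i"] collinear_graph[of _ "m i" "c i"]
        SM[OF ij(1)] SM[OF ij(2)] ij(4) by blast
  qed
  then obtain h where h: "bij_betw h {..<card S} S"
    and hm: "\<And>i j. i < j \<Longrightarrow> j < card S \<Longrightarrow> m (h j) < m (h i)"
    using finite_enumerate_by_key[of S "\<lambda>i. - m i"] finS by auto
  have hS: "h i \<in> S" if "i < N" for i using that cardS bij_betwE[OF h] by auto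
  have hinj: "inj_on h {..<N}"
    using bij_betw_imp_inj_on[OF h] by (rule inj_on_subset) (use cardS in auto)
  show ?thesis
  proof (rule that[of h "\<lambda>i. m (h i)" "\<lambda>i. c (h i)"])
    show "h i < M" if "i < N" for i using hS[OF that] SM by simp
    show "inj_on h {..<N}" by (rule hinj)
    show "m (h j) < m (h i)" if "j < N" "i < j" for i j using hm that cardS by simp
    fix i j assume ij: "i < N" "j < N" "i \<noteq> j"
    then have "h i \<noteq> h j" using hinj by (auto simp: inj_on_def)
    then have "s (h i) \<inter> s (h j) \<noteq> {}" using smeet hS SM ij by simp
    then show "(K (h i) \<inter> graph_line (m (h i)) (c (h i))) \<inter> (K (h j) \<inter> graph_line (m (h j)) (c (h j))) \<noteq> {}"
      using sK[OF SM, OF hS, OF ij(1)] sK[OF SM, OF hS, OF ij(2)]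
        line[OF hS, OF ij(1)] line[OF hS, OF ij(2)] by blast
  qed
qed

theorem theorem2p2:
  fixes n :: nat
  assumes "n \<ge> 1"
  shows "\<exists>N::nat. N \<ge> n \<and> N \<ge> 3 \<and>
    (\<forall>F :: (real^2) set set.
       strictly_2_intersecting F \<and> card F = N \<and> (\<forall>A\<in>F. compact A \<and> convex A) \<longrightarrow>
       (\<exists>K l. inj_on K {1..n} \<and> K ` {1..n} \<subseteq> F \<and>
          realized_by n K l \<and> (n_cap n l \<or> n_cup n l)))"
proof -
  obtain N3 where N3: "\<forall>P :: nat \<Rightarrow> nat \<Rightarrow> nat \<Rightarrow> nat \<Rightarrow> bool.
    (\<forall>h<N3. \<forall>j<h. \<forall>i<j. \<exists>k<2. P k i j h) \<longrightarrow>
    (\<exists>k<2. \<exists>g. (\<forall>i<n. g i < N3) \<and> (\<forall>j<n. \<forall>i<j. g i < g j) \<and>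
      (\<forall>h<n. \<forall>j<h. \<forall>i<j. P k (g i) (g j) (g h)))"
    using ramsey_increasing_3[where c = 2 and m = n] by (rule exE)
  obtain N where N: "\<And>F. strictly_2_intersecting F \<Longrightarrow> N \<le> card F \<Longrightarrow>
    (\<exists>K a b. inj_on K {..<N3 + 3} \<and> K ` {..<N3 + 3} \<subseteq> F \<and> (\<forall>i<N3 + 3. a i \<in> K i \<and> b i \<in> K i) \<and>
      (\<forall>j<N3 + 3. \<forall>i<j. closed_segment (a i) (b i) \<inter> closed_segment (a j) (b j) \<noteq> {}))"
    using crossing_segments[of "N3 + 3"] by metis
  show ?thesis
  \<comment> \<open>The summands \<open>n\<close> and 3 secure the two lower bounds on the size of
    the family.\<close>
  proof (rule exI[of _ "N + n + 3"], intro conjI allI impI, goal_cases)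
    case (3 F)
    then have F: "strictly_2_intersecting F" and "N \<le> card F" by auto
    from N[OF this] obtain K a b where inj: "inj_on K {..<N3 + 3}" and KF: "K ` {..<N3 + 3} \<subseteq> F"
      and ab: "\<forall>i<N3 + 3. a i \<in> K i \<and> b i \<in> K i"
      and meet: "\<forall>j<N3 + 3. \<forall>i<j. closed_segment (a i) (b i) \<inter> closed_segment (a j) (b j) \<noteq> {}"
      by (elim exE conjE) (rule that)
    obtain h m c where h: "\<And>i. i < N3 \<Longrightarrow> h i < N3 + 3" "inj_on h {..<N3}"
      and m: "\<And>i j. j < N3 \<Longrightarrow> i < j \<Longrightarrow> m j < m i"
      and real: "\<And>i j. i < N3 \<Longrightarrow> j < N3 \<Longrightarrow> i \<noteq> j \<Longrightarrow>
        (K (h i) \<inter> graph_line (m i) (c i)) \<inter> (K (h j) \<inter> graph_line (m j) (c j)) \<noteq> {}"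
      by (rule lines_of_crossing_segments[OF F inj KF, of a b N3]) (use ab meet in auto)
    have Kh_ne: "K (h i) \<noteq> K (h j)" if "i < N3" "j < N3" "i \<noteq> j" for i j
      using inj_on_eq_iff[OF inj, of "h i" "h j"] inj_on_eq_iff[OF h(2), of i j] h(1) that by simp
    define x where "x i k = (c k - c i) / (m i - m k)" for i k
    have x: "graph_line (m i) (c i) \<inter> graph_line (m k) (c k) = {vector [x i k, m i * x i k + c i]}"
      if "k < N3" "i < k" for i k
      using graph_line_Int[of "m i" "m k" "c i" "c k"] m[OF that] by (simp add: x_def)
    \<comment> \<open>For \<open>i < j < k\<close>, type 0 says that the crossing point of the outer
      lines is above the middle line, type 1 that it is below.\<close>
    define P where "P t i j k \<longleftrightarrow>
      t = 0 \<and> m j * x i k + c j < m i * x i k + c i \<or>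
      t = 1 \<and> m i * x i k + c i < m j * x i k + c j" for t i j k :: nat
    have "\<forall>k<N3. \<forall>j<k. \<forall>i<j. \<exists>t<2. P t i j k"
    proof (intro allI impI)
      fix i j k assume ijk: "k < N3" "j < k" "i < j"
      \<comment> \<open>Equality would make the three lines concurrent at a point \<open>p\<close>.
        Two of the lines meet only there, so \<open>p\<close> is the point that their sets share,
        and it would lie in three sets.\<close>
      have "m j * x i k + c j \<noteq> m i * x i k + c i"
      proof
        assume eq: "m j * x i k + c j = m i * x i k + c i"
        define p :: "real^2" where "p = vector [x i k, m i * x i k + c i]"
        have p: "p \<in> graph_line (m i) (c i)" "p \<in> graph_line (m k) (c k)"
          using x[of k i] ijk by (auto simp: p_def)
        have pj: "p \<in> graph_line (m j) (c j)" using eq by (simp add: p_def graph_line_def)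
        have pK: "p \<in> K (h i) \<and> p \<in> K (h k')" if k': "k' = j \<or> k' = k" for k'
        proof -
          have "(K (h i) \<inter> graph_line (m i) (c i)) \<inter> (K (h k') \<inter> graph_line (m k') (c k')) \<noteq> {}"
            by (rule real) (use k' ijk in auto)
          then obtain z where z: "z \<in> K (h i) \<inter> K (h k')"
            "z \<in> graph_line (m i) (c i) \<inter> graph_line (m k') (c k')" by blast
          have "p \<in> graph_line (m i) (c i) \<inter> graph_line (m k') (c k')" using p pj k' by blast
          moreover have "k' < N3" "i < k'" using k' ijk by auto
          ultimately have "z = p" using z(2) by (simp only: x singleton_iff)
          with z(1) show ?thesis by simp
        qed
        have "p \<in> K (h i) \<inter> K (h j) \<inter> K (h k)" using pK[of j] pK[of k] by simp
        moreover have "K (h i) \<in> F" "K (h j) \<in> F" "K (h k) \<in> F" using KF h(1) ijk by auto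
        moreover have "K (h i) \<noteq> K (h j)" "K (h i) \<noteq> K (h k)" "K (h j) \<noteq> K (h k)"
          using Kh_ne ijk by simp_all
        ultimately show False using F unfolding strictly_2_intersecting_def by blast
      qed
      then have "P 0 i j k \<or> P 1 i j k" by (auto simp: P_def)
      then show "\<exists>t<2. P t i j k" by (auto intro: exI[of _ 0] exI[of _ 1])
    qed
    from N3[THEN spec, of P, THEN mp, OF this]
    obtain t g where t: "t < 2" and gN: "\<forall>i<n. g i < N3" and g: "\<forall>j<n. \<forall>i<j. g i < g j"
      and Pt: "\<forall>k<n. \<forall>j<k. \<forall>i<j. P t (g i) (g j) (g k)"
      by (elim exE conjE) (rule that)
    \<comment> \<open>The slopes decrease along \<open>g\<close>, as a cap requires; for a cup the
      order is reversed. Either way the indices are shifted from \<open>0, ..., n - 1\<close> to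
      \<open>1, ..., n\<close>.\<close>
    define r where "r i = (if t = 0 then g (i - 1) else g (n - i))" for i
    have rN: "r i < N3" if "i \<in> {1..n}" for i using that gN by (auto simp: r_def)
    have rne: "r i \<noteq> r j" if "i \<in> {1..n}" "j \<in> {1..n}" "i < j" for i j
    proof (cases "t = 0")
      case True
      then have "r i < r j" using that g by (simp add: r_def)
      then show ?thesis by simp
    next
      case False
      then have "r j < r i" using that g by (simp add: r_def)
      then show ?thesis by simp
    qed
    show ?case
    proof (intro exI conjI)
      show "inj_on (\<lambda>i. K (h (r i))) {1..n}"
        using Kh_ne rne rN by (intro linorder_inj_onI) auto
      show "(\<lambda>i. K (h (r i))) ` {1..n} \<subseteq> F" using rN h KF by auto
      show "realized_by n (\<lambda>i. K (h (r i))) (\<lambda>i. graph_line (m (r i)) (c (r i)))"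
        unfolding realized_by_def using is_line_graph_line real rN rne by auto
      show "n_cap n (\<lambda>i. graph_line (m (r i)) (c (r i))) \<or> n_cup n (\<lambda>i. graph_line (m (r i)) (c (r i)))"
      proof (cases "t = 0")
        case True
        have "n_cap n (\<lambda>i. graph_line (m (r i)) (c (r i)))"
        proof (rule n_cap_graph_line)
          fix i j assume "1 \<le> i" "i < j" "j \<le> n"
          then show "m (r j) < m (r i)" using True g gN by (auto simp: r_def intro!: m)
        next
          fix i j k assume "1 \<le> i" "i < j" "j < k" "k \<le> n"
          then show "m (r j) * ((c (r k) - c (r i)) / (m (r i) - m (r k))) + c (r j)
              < m (r i) * ((c (r k) - c (r i)) / (m (r i) - m (r k))) + c (r i)"
            using Pt[rule_format, of "k - 1" "j - 1" "i - 1"] True by (auto simp: r_def P_def x_def)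
        qed
        then show ?thesis ..
      next
        case False
        with t have "t = 1" by simp
        have "n_cup n (\<lambda>i. graph_line (m (r i)) (c (r i)))"
        proof (rule n_cup_graph_line)
          fix i j assume "1 \<le> i" "i < j" "j \<le> n"
          then show "m (r i) < m (r j)" using False g gN by (auto simp: r_def intro!: m)
        next
          fix i j k assume "1 \<le> i" "i < j" "j < k" "k \<le> n"
          then show "m (r k) * ((c (r i) - c (r k)) / (m (r k) - m (r i))) + c (r k)
              < m (r j) * ((c (r i) - c (r k)) / (m (r k) - m (r i))) + c (r j)"
            using Pt[rule_format, of "n - i" "n - j" "n - k"] \<open>t = 1\<close> by (auto simp: r_def P_def x_def)
        qed
        then show ?thesis ..
      qed
    qed
  qed auto
qed

end
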